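(* Among all integers $n$ with $k=\omega(n)\ge 44$ and $\lambda(n)\ge 1$, the largest one is $n_*=\prod_{i=1}^{44}p_i^{a_i}$, where $p_i$ is the $i$-th prime and $(a_1,\dots,a_{44})$ is $$(354, 223, 152, 125, 102, 95, 86, 83, 77, 72, 71, 67, 65, 64, 63, 61, 59, 59, 57, 57, 56, 55, 55, 54, 53, 52, 52, 52, 51, 51, 50, 49, 49, 49, 48, 48, 48, 47, 47, 47, 46, 46, 46, 46).$$
   Context: $\tau(n)$ denotes the number of positive divisors of $n$ and $\omega(n)$ the number of distinct prime factors of $n$. For an integer $n$ with $k=\omega(n)\ge 2$, $\lambda(n):=\dfrac{(\tau(n)^{1/k}-1)k\log k}{\log n}$, i.e. $\tau(n)=\bigl(1+\frac{\lambda(n)\log n}{k\log k}\bigr)^k$. *)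

theory Defs
  imports Complex_Main "HOL-Computational_Algebra.Primes" "HOL-Library.Infinite_Set"
begin

definition tau :: "nat \<Rightarrow> nat" where
  "tau n = card {d. d dvd n}"

definition omega :: "nat \<Rightarrow> nat" where
  "omega n = card (prime_factors n)"

(* Meaningful for omega n \<ge> 2; then n \<ge> 6, so the denominator is positive. *)
definition lambda :: "nat \<Rightarrow> real" where
  "lambda n =
     (let k = omega n in
       (real (tau n) powr (1 / real k) - 1) * real k * ln (real k) / ln (real n))"

(* Indexed from 1: nth_prime 1 = 2.  Since enumerate counts from 0, nth_prime 0 is junk. *)
definition nth_prime :: "nat \<Rightarrow> nat" where
  "nth_prime i = enumerate {p. prime p} (i - 1)"

definition exponents :: "nat list" where
  "exponents =
     [354, 223, 152, 125, 102, 95, 86, 83, 77, 72, 71, 67, 65, 64, 63, 61, 59, 59, 57, 57, 56,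
      55, 55, 54, 53, 52, 52, 52, 51, 51, 50, 49, 49, 49, 48, 48, 48, 47, 47, 47, 46, 46, 46, 46]"

definition n_star :: nat where
  "n_star = (\<Prod>i = 1..44. nth_prime i ^ (exponents ! (i - 1)))"

end

theory Submission
  imports Defs "HOL-Library.FuncSet" "HOL-Analysis.Harmonic_Numbers" "HOL-Analysis.Convex"
begin

text \<open>
  Let \<open>k = omega n\<close>, let \<open>a\<^sub>i\<close> be the exponents of \<open>n\<close> and \<open>l\<^sub>i\<close> the logarithm of the \<open>i\<close>-th prime, so that
  \<open>ln n \<ge> (\<Sum>i. a\<^sub>i * l\<^sub>i)\<close>, while \<open>lambda n \<ge> 1\<close> means
  \<open>(1 + ln n / (k * ln k)) ^ k \<le> tau n = (\<Prod>i. a\<^sub>i + 1)\<close>.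
  The inequality of the means for the numbers \<open>(a\<^sub>i + 1) * l\<^sub>i\<close> bounds \<open>tau n\<close> in terms of \<open>ln n\<close>; once
  the geometric mean of the \<open>l\<^sub>i\<close> exceeds \<open>ln k\<close>, which happens from \<open>k = 44\<close> on, this bounds \<open>ln n\<close>.
  For \<open>k \<ge> 45\<close> the bound lies below \<open>ln n_star\<close> or below the logarithm of the primorial;
  the primes enter only through a sieve modulo \<open>210\<close>.

  For \<open>k = 44\<close> the bound is about \<open>ln n_star + 120\<close>. Here \<open>n_star\<close> maximises
  \<open>ln (tau n) - \<epsilon> * ln n\<close> for \<open>\<epsilon> = 0.0040667\<close>, and raising any of its exponents costs more
  than the slack in \<open>lambda n_star \<ge> 1\<close>. As \<open>ln (tau n)\<close> is compared with a concave function of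
  \<open>ln n\<close>, this excludes the numbers up to \<open>ln n_star + 22\<close>, and two smaller values of \<open>\<epsilon>\<close> exclude the rest.
\<close>

section \<open>Primes and factorizations\<close>

abbreviation prime_seq :: "nat \<Rightarrow> nat"
  where "prime_seq \<equiv> enumerate {p. prime p}"

lemma infinite_primes: "infinite {p::nat. prime p}"
  using primes_infinite by simp

lemma prime_prime_seq: "prime (prime_seq i)"
  using enumerate_in_set[OF infinite_primes] by simp

text \<open>Applied to the prime factors of \<open>n\<close> inside the set of all primes, this puts
  the \<open>i\<close>-th smallest prime factor at or above the \<open>i\<close>-th prime.\<close>

lemma enumerate_subset_le:
  fixes S T :: "nat set"
  assumes "finite S" "S \<subseteq> T" "infinite T" "i < card S"
  shows "enumerate T i \<le> enumerate S i"
  using \<open>i < card S\<close>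
proof (induction i)
  case 0
  then have "enumerate S 0 \<in> T"
    using finite_enumerate_in_set[OF assms(1)] assms(2) by blast
  then show ?case by (simp add: enumerate_0 Least_le)
next
  case (Suc i)
  then have "enumerate T i < enumerate S (Suc i)"
    using finite_enumerate_step[OF assms(1), of i] by simp
  moreover have "enumerate S (Suc i) \<in> T"
    using finite_enumerate_in_set[OF assms(1)] Suc.prems assms(2) by blast
  ultimately show ?case
    by (subst enumerate_Suc''[OF assms(3)]) (simp add: Least_le)
qed

text \<open>Turns a verified table into values of \<open>enumerate\<close>: elements of
  \<open>S\<close> from \<open>N\<close> on exceed the whole table, so the position in the sorted
  table is the position in \<open>S\<close>.\<close>

lemma enumerate_eq_nth:
  fixes S :: "nat set"
  assumes "infinite S" "sorted_wrt (<) xs" "set xs = {x \<in> S. x < N}" "i < length xs"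
  shows "enumerate S i = xs ! i"
  using \<open>i < length xs\<close>
proof (induction i)
  case 0
  have "xs ! 0 \<in> S" "\<And>y. y \<in> S \<Longrightarrow> xs ! 0 \<le> y"
  proof -
    show "xs ! 0 \<in> S" using assms(3) 0 nth_mem by blast
    fix y assume "y \<in> S"
    show "xs ! 0 \<le> y"
    proof (cases "y < N")
      case True
      then obtain j where "j < length xs" "y = xs ! j"
        using \<open>y \<in> S\<close> assms(3) by (metis (mono_tags, lifting) in_set_conv_nth mem_Collect_eq)
      then show ?thesis
        using assms(2) 0 by (cases "j = 0") (auto simp: sorted_wrt_iff_nth_less less_imp_le)
    next
      case False
      then show ?thesis using assms(3) nth_mem[OF 0] by auto
    qed
  qed
  then show ?case unfolding enumerate_0 by (intro Least_equality)
next
  case (Suc i)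
  have "enumerate S (Suc i) = (LEAST s. s \<in> S \<and> enumerate S i < s)"
    by (rule enumerate_Suc''[OF assms(1)])
  also have "\<dots> = xs ! Suc i"
  proof (rule Least_equality)
    show "xs ! Suc i \<in> S \<and> enumerate S i < xs ! Suc i"
      using Suc assms(2,3) nth_mem[OF Suc.prems] by (auto simp: sorted_wrt_iff_nth_less)
    fix y assume y: "y \<in> S \<and> enumerate S i < y"
    show "xs ! Suc i \<le> y"
    proof (cases "y < N")
      case True
      then obtain j where j: "j < length xs" "y = xs ! j"
        using y assms(3) by (metis (mono_tags, lifting) in_set_conv_nth mem_Collect_eq)
      have "i < j"
      proof (rule ccontr)
        assume "\<not> i < j"
        then have "xs ! j \<le> xs ! i"
          using assms(2) Suc.prems
          by (cases "i = j") (auto simp: sorted_wrt_iff_nth_less less_imp_le)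
        then show False using y j Suc by simp
      qed
      then show ?thesis
        using assms(2) j by (cases "j = Suc i") (auto simp: sorted_wrt_iff_nth_less less_imp_le)
    next
      case False
      then show ?thesis using assms(3) nth_mem[OF Suc.prems] by auto
    qed
  qed
  finally show ?case .
qed

definition small_primes :: "nat list" where
  "small_primes =
  [2, 3, 5, 7, 11, 13, 17, 19, 23, 29, 31, 37, 41, 43, 47, 53, 59, 61, 67, 71, 73, 79, 83, 89,
   97, 101, 103, 107, 109, 113, 127, 131, 137, 139, 149, 151, 157, 163, 167, 173, 179, 181, 191,
   193, 197, 199, 211, 223, 227, 229, 233, 239, 241, 251, 257, 263, 269, 271, 277, 281, 283, 293,
   307, 311, 313, 317, 331, 337, 347, 349, 353, 359, 367, 373, 379, 383, 389, 397, 401, 409, 419,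
   421, 431, 433, 439, 443, 449, 457, 461, 463, 467, 479, 487, 491, 499]"

lemma length_small_primes: "length small_primes = 95"
  by (simp add: small_primes_def)

text \<open>Since 500 < 23^2, a composite \<open>n\<close> has a divisor between 2 and 22, which in
  turn has a prime factor of at most 19.\<close>

lemma prime_iff_no_small_divisor:
  fixes n :: nat
  assumes "2 \<le> n" "n < 500"
  shows "prime n \<longleftrightarrow> (\<forall>d\<in>set [2, 3, 5, 7, 11, 13, 17, 19]. d dvd n \<longrightarrow> d = n)"
proof
  assume "prime n"
  show "\<forall>d\<in>set [2, 3, 5, 7, 11, 13, 17, 19]. d dvd n \<longrightarrow> d = n"
  proof (intro ballI impI)
    fix d assume "d \<in> set [2, 3, 5, 7, 11, 13, 17, 19]" "d dvd n"
    moreover from this have "d \<noteq> 1" by auto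
    ultimately show "d = n" using \<open>prime n\<close> by (auto simp: prime_nat_iff)
  qed
next
  assume *: "\<forall>d\<in>set [2, 3, 5, 7, 11, 13, 17, 19]. d dvd n \<longrightarrow> d = n"
  show "prime n"
  proof (rule ccontr)
    assume "\<not> prime n"
    then obtain a where a: "a dvd n" "a \<noteq> 1" "a \<noteq> n"
      using assms by (auto simp: prime_nat_iff)
    then obtain b where "n = a * b" by auto
    then have ab: "n = a * b" "1 < a" "1 < b" "a < n" "b < n"
      using a assms by (auto simp: nat_neq_iff)
    define d where "d = min a b"
    have d: "d dvd n" "d < n" "d > 1" using ab by (auto simp: d_def min_def)
    have "d * d \<le> a * b" unfolding d_def by (intro mult_mono) auto
    have "d < 23"
    proof (rule ccontr)
      assume "\<not> d < 23"
      then have "23 * 23 \<le> d * d" by (intro mult_mono) auto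
      with \<open>d * d \<le> a * b\<close> ab assms show False by simp
    qed
    have "d \<in> set [2..<23]"
      using \<open>d < 23\<close> d by (simp del: upt_rec_numeral)
    then have "d \<in> {2,3,4,5,6,7,8,9,10,11,12,13,14,15,16,17,18,19,20,21,22}"
      by simp
    then have "2 dvd d \<or> 3 dvd d \<or> 5 dvd d \<or> 7 dvd d \<or> 11 dvd d \<or> 13 dvd d \<or> 17 dvd d \<or> 19 dvd d"
      by auto
    then obtain e where e: "e \<in> set [2, 3, 5, 7, 11, 13, 17, 19]" "e dvd d"
      by auto
    then have "e = n" using * d(1) dvd_trans by blast
    then show False using e d by (auto dest: dvd_imp_le)
  qed
qed

lemma set_small_primes: "set small_primes = {p. prime p \<and> p < 500}"
proof -
  let ?P = "\<lambda>n::int. \<forall>d\<in>set [2, 3, 5, 7, 11, 13, 17, 19]. d dvd n \<longrightarrow> d = n"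
  \<comment> \<open>Trial division is evaluated over \<open>int\<close>, where numerals are computed
    in binary, and the result is then carried back to \<open>nat\<close>.\<close>
  have "map int small_primes = filter ?P [2..499]"
    unfolding small_primes_def list.map of_nat_numeral by code_simp
  from arg_cong[OF this, of set] have "int ` set small_primes = {n \<in> {2..499}. ?P n}"
    by (simp only: set_map set_filter set_upto)
  then have "int n \<in> int ` set small_primes \<longleftrightarrow> int n \<in> {2..499} \<and> ?P (int n)" for n
    by (simp only: mem_Collect_eq)
  moreover have "?P (int n) \<longleftrightarrow> prime n" if "2 \<le> n" "n < 500" for n
  proof -
    have "(numeral w :: int) dvd int n \<longleftrightarrow> numeral w dvd n" "(numeral w = int n) = (numeral w = n)" for w
      by (metis of_nat_numeral int_dvd_int_iff, metis of_nat_numeral of_nat_eq_iff)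
    then show ?thesis using prime_iff_no_small_divisor[OF that] by simp
  qed
  ultimately have "n \<in> set small_primes \<longleftrightarrow> prime n \<and> n < 500" for n
    using prime_ge_2_nat[of n] unfolding inj_image_mem_iff[OF inj_of_nat]
    by (cases "2 \<le> n \<and> n < 500") (auto simp del: list.set)
  then show ?thesis by blast
qed

lemma prime_seq_eq_nth: "i < 95 \<Longrightarrow> prime_seq i = small_primes ! i"
proof (rule enumerate_eq_nth[OF infinite_primes, where N = 500])
  show "sorted_wrt (<) small_primes"
    by (simp add: small_primes_def)
  show "set small_primes = {x \<in> {p. prime p}. x < 500}"
    by (simp add: set_small_primes)
  show "i < 95 \<Longrightarrow> i < length small_primes"
    by (simp add: length_small_primes)
qed

section \<open>A sieve modulo 210\<close>

lemma card_coprime_210: "card {r \<in> {0..209::int}. coprime r 210} = 48"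
proof -
  have "{r \<in> {0..209::int}. coprime r 210} = set (filter (\<lambda>r. gcd r 210 = 1) [0..209])"
    by (simp only: set_filter set_upto coprime_iff_gcd_eq_1)
  also have "card \<dots> = length (filter (\<lambda>r::int. gcd r 210 = 1) [0..209])"
    by (rule distinct_card) (simp only: distinct_filter distinct_upto)
  also have "\<dots> = 48" by code_simp
  finally show ?thesis .
qed

lemma coprime_210_prime: "prime p \<Longrightarrow> p > 7 \<Longrightarrow> coprime p (210::nat)"
proof (rule prime_imp_coprime)
  assume p: "prime p" "p > 7"
  show "\<not> p dvd 210"
  proof
    assume "p dvd 210"
    then have "p dvd 2 * 3 * 5 * 7" by simp
    then have "p dvd 2 \<or> p dvd 3 \<or> p dvd 5 \<or> p dvd 7"
      using p(1) by (metis prime_dvd_multD)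
    then show False using p(2) by (auto dest: dvd_imp_le)
  qed
qed

text \<open>Pigeonhole: from \<open>prime_seq 4 = 11\<close> on, primes are coprime to 210 = 2 * 3 *
  5 * 7, and there are only 48 such residues. If 49 consecutive primes lay in a window shorter than
  210, their residues would be distinct.\<close>

lemma prime_seq_add_48:
  assumes "i \<ge> 4"
  shows "prime_seq i + 210 \<le> prime_seq (i + 48)"
proof (rule ccontr)
  assume "\<not> ?thesis"
  then have lt: "prime_seq (i + 48) < prime_seq i + 210" by simp
  define f where "f = (\<lambda>j. int (prime_seq j mod 210))"
  have bounds: "prime_seq i \<le> prime_seq j" "prime_seq j < prime_seq i + 210" if "j \<in> {i..i+48}" for j
    using that lt infinite_primes enumerate_mono_le_iff[of "{p. prime p}"]
    by (auto intro: le_less_trans[OF _ lt])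
  have "prime_seq 4 = 11"
    using prime_seq_eq_nth[of 4] by (simp add: small_primes_def)
  then have big: "prime_seq j > 7" if "j \<in> {i..i+48}" for j
    using that assms enumerate_mono_le_iff[OF infinite_primes, of 4 j] by simp
  have "inj_on f {i..i+48}"
  proof (rule inj_onI)
    fix a b assume ab: "a \<in> {i..i+48}" "b \<in> {i..i+48}" "f a = f b"
    have *: "x = y" if "x mod 210 = y mod 210" "m \<le> x" "x < m + 210" "m \<le> y" "y < m + 210"
      for x y m :: nat
      using that
    proof (induction x y rule: linorder_wlog)
      case (le x y)
      then have "210 dvd y - x" by (metis mod_eq_dvd_iff_nat)
      moreover have "y - x < 210" using le by simp
      ultimately show ?case using le by (auto dest: dvd_imp_le)
    qed auto
    have "prime_seq a = prime_seq b"
      using ab(3) by (intro *[OF _ bounds[OF ab(1)] bounds[OF ab(2)]]) (simp add: f_def)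
    then show "a = b" using inj_enumerate[OF infinite_primes] by (auto dest: injD)
  qed
  moreover have "f ` {i..i+48} \<subseteq> {r \<in> {0..209::int}. coprime r 210}"
  proof safe
    fix j assume "j \<in> {i..i+48}"
    then have "coprime (prime_seq j mod 210) 210"
      using coprime_210_prime[OF prime_prime_seq big] by (simp add: coprime_mod_left_iff)
    then show "coprime (f j) 210"
      unfolding f_def by (metis coprime_int_iff of_nat_numeral)
    show "f j \<in> {0..209}" by (simp add: f_def zmod_int)
  qed
  ultimately have "card {i..i+48} \<le> card {r \<in> {0..209::int}. coprime r 210}"
    by (rule card_inj_on_le) (simp del: atLeastAtMost_iff)
  then show False unfolding card_coprime_210 by simp
qed

text \<open>Advancing the index by 48 adds 35 * 48 = 1680 on the left and at least 8 * 210 = 1680 on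
  the right. The 48 base cases, from 45 to 92, are read off the table.\<close>

lemma prime_seq_lower: "i \<ge> 45 \<Longrightarrow> 35 * i \<le> 8 * prime_seq i"
proof (induction i rule: less_induct)
  case (less i)
  show ?case
  proof (cases "i < 93")
    case True
    have "\<forall>j\<in>set [45..<93]. 35 * j \<le> 8 * small_primes ! j"
      unfolding small_primes_def by simp
    moreover have "i \<in> set [45..<93]"
      using less.prems True by (auto simp del: upt_rec_numeral)
    ultimately have "35 * i \<le> 8 * small_primes ! i" by (rule bspec)
    then show ?thesis using True prime_seq_eq_nth[of i] by simp
  next
    case False
    then have "35 * (i - 48) \<le> 8 * prime_seq (i - 48)" by (intro less.IH) auto
    moreover have "prime_seq (i - 48) + 210 \<le> prime_seq i"
      using prime_seq_add_48[of "i - 48"] False by simp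
    ultimately show ?thesis using False by simp
  qed
qed

section \<open>The divisor function and the condition on lambda\<close>

lemma tau_eq_prod:
  assumes "n > 0"
  shows "tau n = (\<Prod>p\<in>prime_factors n. multiplicity p n + 1)"
proof -
  let ?B = "\<lambda>p. {..multiplicity p n}"
  let ?f = "\<lambda>d. restrict (\<lambda>p. multiplicity p d) (prime_factors n)"
  \<comment> \<open>A divisor corresponds to its exponents at the primes dividing \<open>n\<close>,
    each chosen freely up to the multiplicity in \<open>n\<close>.\<close>
  have "bij_betw ?f {d. d dvd n} (PiE (prime_factors n) ?B)"
  proof (rule bij_betwI[where g = "\<lambda>h. \<Prod>p\<in>prime_factors n. p ^ h p"])
    have mult: "multiplicity p (\<Prod>p\<in>prime_factors n. p ^ h p) = (if p \<in> prime_factors n then h p else 0)"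
      if "prime p" for p and h :: "nat \<Rightarrow> nat"
      using that by (intro multiplicity_prod_prime_powers) auto
    show "?f \<in> {d. d dvd n} \<rightarrow> PiE (prime_factors n) ?B"
      using assms by (auto intro: dvd_imp_multiplicity_le)
    show "(\<lambda>h. \<Prod>p\<in>prime_factors n. p ^ h p) \<in> PiE (prime_factors n) ?B \<rightarrow> {d. d dvd n}"
    proof
      fix h assume h: "h \<in> PiE (prime_factors n) ?B"
      have "(\<Prod>p\<in>prime_factors n. p ^ h p) \<noteq> 0" by (auto simp: prime_gt_0_nat)
      then have "(\<Prod>p\<in>prime_factors n. p ^ h p) dvd n"
        by (rule multiplicity_le_imp_dvd) (use h in \<open>auto simp: mult PiE_iff\<close>)
      then show "(\<Prod>p\<in>prime_factors n. p ^ h p) \<in> {d. d dvd n}" by simp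
    qed
    show "(\<Prod>p\<in>prime_factors n. p ^ ?f d p) = d" if "d \<in> {d. d dvd n}" for d
    proof (rule multiplicity_eq_nat)
      show "d > 0" using that assms by (auto intro: Nat.gr0I)
      show "(\<Prod>p\<in>prime_factors n. p ^ ?f d p) > 0"
        by (auto intro!: prod_pos simp: prime_gt_0_nat in_prime_factors_imp_prime)
      fix p :: nat assume p: "prime p"
      show "multiplicity p (\<Prod>p\<in>prime_factors n. p ^ ?f d p) = multiplicity p d"
      proof (cases "p \<in> prime_factors n")
        case True
        then show ?thesis using mult[OF p] by simp
      next
        case False
        then have "\<not> p dvd n" using p assms by (simp add: prime_factors_dvd)
        then have "\<not> p dvd d" using that by auto
        then show ?thesis using mult[OF p] False by (simp add: not_dvd_imp_multiplicity_0)
      qed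
    qed
    show "?f (\<Prod>p\<in>prime_factors n. p ^ h p) = h" if "h \<in> PiE (prime_factors n) ?B" for h
      using that by (auto simp: fun_eq_iff mult PiE_iff extensional_def in_prime_factors_imp_prime)
  qed
  then have "tau n = card (PiE (prime_factors n) ?B)"
    unfolding tau_def by (rule bij_betw_same_card)
  then show ?thesis by (simp add: card_PiE)
qed

text \<open>The prime factors are listed in increasing order, which makes the comparison with
  \<open>prime_seq\<close> possible index by index.\<close>

lemma factorization_sorted:
  assumes "n > 0"
  shows "\<exists>q a :: nat \<Rightarrow> nat. (\<forall>i<omega n. prime_seq i \<le> q i \<and> a i \<ge> 1) \<and>
    n = (\<Prod>i<omega n. q i ^ a i) \<and> tau n = (\<Prod>i<omega n. a i + 1)"
proof -
  let ?S = "prime_factors n"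
  define q where "q = enumerate ?S"
  define a where "a i = multiplicity (q i) n" for i
  have bij: "bij_betw q {..<omega n} ?S"
    unfolding q_def omega_def by (intro finite_bij_enumerate) simp
  have "prime_seq i \<le> q i" if "i < omega n" for i
    unfolding q_def using that
    by (intro enumerate_subset_le infinite_primes) (auto simp: omega_def)
  moreover have "a i \<ge> 1" if "i < omega n" for i
  proof -
    have "q i \<in> ?S" using bij that by (auto simp: bij_betw_def)
    then show ?thesis
      unfolding a_def by (metis One_nat_def Suc_leI prime_factors_multiplicity mem_Collect_eq)
  qed
  moreover have "n = (\<Prod>i<omega n. q i ^ a i)"
    unfolding a_def
    by (subst prime_factorization_nat[OF assms], subst prod.reindex_bij_betw[OF bij, symmetric]) simp
  moreover have "tau n = (\<Prod>i<omega n. a i + 1)"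
    unfolding a_def tau_eq_prod[OF assms]
    by (subst prod.reindex_bij_betw[OF bij, symmetric]) simp
  ultimately show ?thesis by blast
qed

text \<open>Clears the root: \<open>t = tau n powr (1 / k)\<close> satisfies
  \<open>t ^ k = tau n\<close>, and taking \<open>k\<close>-th powers preserves the order of
  nonnegative reals.\<close>

lemma one_le_lambda_iff:
  assumes "n > 1" "omega n \<ge> 2"
  shows "lambda n \<ge> 1 \<longleftrightarrow> (1 + ln n / (omega n * ln (omega n))) ^ omega n \<le> tau n"
proof -
  let ?k = "omega n"
  define t where "t = real (tau n) powr (1 / ?k)"
  have pos: "ln n > 0" "real ?k * ln ?k > 0"
    using assms by auto
  have "tau n > 0"
    using assms unfolding tau_def by (auto simp: card_gt_0_iff intro: exI[of _ 1])
  then have t: "t > 0" "t ^ ?k = tau n"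
    using assms by (simp_all add: t_def powr_realpow[symmetric] powr_powr)
  have "lambda n \<ge> 1 \<longleftrightarrow> ln n \<le> (t - 1) * (?k * ln ?k)"
    using pos unfolding lambda_def t_def by (simp add: Let_def mult.assoc)
  also have "\<dots> \<longleftrightarrow> 1 + ln n / (?k * ln ?k) \<le> t"
    using pos by (simp add: pos_le_divide_eq pos_divide_le_eq le_diff_eq[symmetric] add.commute[of 1])
  also have "\<dots> \<longleftrightarrow> (1 + ln n / (?k * ln ?k)) ^ ?k \<le> t ^ ?k"
    using pos t assms by (intro power_mono_iff[symmetric]) auto
  finally show ?thesis by (simp add: t)
qed

section \<open>Rational bounds for logarithms of primes\<close>

definition artanh_horner :: "real \<Rightarrow> real" where
  "artanh_horner z =
     1 + z * (1 / 3 + z * (1 / 5 + z * (1 / 7 + z * (1 / 9 + z * (1 / 11 + z * (1 / 13 + z * (1 / 15 + z * (1 / 17 + z * (1 / 19 + z * (1 / 21 + z * (1 / 23 + z * (1 / 25))))))))))))"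

text \<open>The first 13 terms of 2 artanh y, which equals ln x for y = (x - 1) / (x + 1). The
  Horner polynomial above is the sum of z^j / (2j + 1) for j up to 12, taken at z = y^2.\<close>

definition artanh_series :: "real \<Rightarrow> real" where
  "artanh_series y = 2 * y * artanh_horner (y\<^sup>2)"

lemma ln_bounds_artanh_series:
  fixes x :: real
  assumes "x > 1"
  defines "y \<equiv> (x - 1) / (x + 1)"
  shows "artanh_series y \<le> ln x" "ln x \<le> artanh_series y + 2 * y ^ 27 / (27 * (1 - y\<^sup>2))"
proof -
  have "(\<Sum>k<13. 2 * y ^ (2 * k + 1) / real (2 * k + 1)) = artanh_series y"
    by (simp add: artanh_series_def artanh_horner_def eval_nat_numeral algebra_simps)
  then show "artanh_series y \<le> ln x" "ln x \<le> artanh_series y + 2 * y ^ 27 / (27 * (1 - y\<^sup>2))"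
    using ln_approx_bounds[of x 13] assms by (simp_all add: algebra_simps)
qed

lemma ln_2_bounds: "693147180559 / 10 ^ 12 \<le> ln (2::real)" "ln (2::real) \<le> 693147180560 / 10 ^ 12"
  using ln_bounds_artanh_series[of 2] by (simp_all add: artanh_series_def artanh_horner_def power_divide)

text \<open>Splitting off \<open>2 ^ m\<close> leaves the logarithm of \<open>p / 2 ^ m\<close>.
  When this quotient is at most 2, \<open>y\<close> is at most 1/3 and the truncated series is
  accurate enough.\<close>

lemma ln_bounds_pow2:
  fixes p :: real and m :: nat
  assumes "p > 2 ^ m" and y: "y = (p - 2 ^ m) / (p + 2 ^ m)"
    and "a \<le> m * (693147180559 / 10 ^ 12) + artanh_series y"
    and "m * (693147180560 / 10 ^ 12) + artanh_series y + 2 * y ^ 27 / (27 * (1 - y\<^sup>2)) \<le> b"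
  shows "a \<le> ln p \<and> ln p \<le> b"
proof -
  have "ln p = ln (2 ^ m * (p / 2 ^ m))" by simp
  also have "\<dots> = ln (2 ^ m) + ln (p / 2 ^ m)"
    using less_trans[OF _ assms(1), of 0] by (intro ln_mult_pos) simp_all
  finally have "ln p = m * ln 2 + ln (p / 2 ^ m)" by (simp add: ln_realpow)
  moreover have "(p / 2 ^ m - 1) / (p / 2 ^ m + 1) = y"
    using assms(1) less_trans[OF _ assms(1), of 0] unfolding y by (simp add: divide_simps)
  ultimately show ?thesis
    using ln_bounds_artanh_series[of "p / 2 ^ m"] assms
      mult_left_mono[OF ln_2_bounds(1), of m] mult_left_mono[OF ln_2_bounds(2), of m]
    by simp
qed

text \<open>The homogeneous form of \<open>artanh_horner\<close> at z / w, multiplied by w^12 and by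
  1673196525, the least common multiple of 1, 3, 5, ..., 25, so that all coefficients are
  integers.\<close>

definition artanh_form :: "int \<Rightarrow> int \<Rightarrow> int" where
  "artanh_form z w = 1673196525 * w ^ 12 + 557732175 * z * w ^ 11 + 334639305 * z ^ 2 * w ^ 10 + 239028075 * z ^ 3 * w ^ 9 + 185910725 * z ^ 4 * w ^ 8 + 152108775 * z ^ 5 * w ^ 7 + 128707425 * z ^ 6 * w ^ 6 + 111546435 * z ^ 7 * w ^ 5 + 98423325 * z ^ 8 * w ^ 4 + 88062975 * z ^ 9 * w ^ 3 + 79676025 * z ^ 10 * w ^ 2 + 72747675 * z ^ 11 * w + 66927861 * z ^ 12"

lemma artanh_series_eq_form:
  fixes u v :: int
  assumes "v > 0"
  shows "artanh_series (u / v) = 2 * u * artanh_form (u\<^sup>2) (v\<^sup>2) / (1673196525 * v ^ 25)"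
proof -
  define z w :: real where "z = u\<^sup>2" and "w = v\<^sup>2"
  have "w > 0" using assms by (simp add: w_def)
  have "1673196525 * artanh_horner (z / w) * w ^ 12 = 1673196525 * w ^ 12 + 557732175 * z * w ^ 11 + 334639305 * z ^ 2 * w ^ 10 + 239028075 * z ^ 3 * w ^ 9 + 185910725 * z ^ 4 * w ^ 8 + 152108775 * z ^ 5 * w ^ 7 + 128707425 * z ^ 6 * w ^ 6 + 111546435 * z ^ 7 * w ^ 5 + 98423325 * z ^ 8 * w ^ 4 + 88062975 * z ^ 9 * w ^ 3 + 79676025 * z ^ 10 * w ^ 2 + 72747675 * z ^ 11 * w + 66927861 * z ^ 12"
  proof -
    have "1673196525 * artanh_horner t * w ^ 12 = 1673196525 * w ^ 12 + 557732175 * (t * w) * w ^ 11 + 334639305 * (t * w) ^ 2 * w ^ 10 + 239028075 * (t * w) ^ 3 * w ^ 9 + 185910725 * (t * w) ^ 4 * w ^ 8 + 152108775 * (t * w) ^ 5 * w ^ 7 + 128707425 * (t * w) ^ 6 * w ^ 6 + 111546435 * (t * w) ^ 7 * w ^ 5 + 98423325 * (t * w) ^ 8 * w ^ 4 + 88062975 * (t * w) ^ 9 * w ^ 3 + 79676025 * (t * w) ^ 10 * w ^ 2 + 72747675 * (t * w) ^ 11 * w + 66927861 * (t * w) ^ 12" for t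
      unfolding artanh_horner_def by algebra
    from this[of "z / w"] show ?thesis using \<open>w > 0\<close> by simp
  qed
  also have "\<dots> = artanh_form (u\<^sup>2) (v\<^sup>2)"
    by (simp add: artanh_form_def z_def w_def)
  finally have "artanh_horner (z / w) = artanh_form (u\<^sup>2) (v\<^sup>2) / (1673196525 * w ^ 12)"
    using \<open>w > 0\<close> by (simp add: field_simps)
  moreover have "real_of_int v ^ 25 = v * w ^ 12"
    by (simp add: w_def flip: power_mult power_Suc)
  ultimately show ?thesis
    using assms unfolding artanh_series_def by (simp add: power_divide z_def w_def)
qed

text \<open>With \<open>u / v = (p - 2 ^ m) / (p + 2 ^ m)\<close>, this is the inclusion of \<open>ln p\<close> between \<open>c / 10 ^ 10\<close>
  and \<open>(c + 2) / 10 ^ 10\<close> after clearing denominators, so that it can be decided by integer arithmetic.\<close>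

definition ln_check :: "int \<Rightarrow> int \<Rightarrow> int \<Rightarrow> int \<Rightarrow> bool" where
  "ln_check c m u v \<longleftrightarrow> v > 0 \<and> u > 0 \<and> v > u \<and>
     (let h = 2 * 10 ^ 12 * u * artanh_form (u\<^sup>2) (v\<^sup>2); d = 1673196525 * v ^ 25; e = 27 * (v\<^sup>2 - u\<^sup>2)
      in 100 * c * d \<le> 693147180559 * m * d + h \<and>
         (693147180560 * m * d + h) * e + 2 * 10 ^ 12 * 1673196525 * u ^ 27 \<le> 100 * (c + 2) * d * e)"

lemma ln_check:
  fixes c p :: int and m :: nat
  assumes "ln_check c m (p - 2 ^ m) (p + 2 ^ m)"
  shows "c / 10 ^ 10 \<le> ln (real_of_int p)" "ln (real_of_int p) \<le> (c + 2) / 10 ^ 10"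
proof -
  define u v where "u = p - 2 ^ m" and "v = p + 2 ^ m"
  define h d e where "h = 2 * 10 ^ 12 * u * artanh_form (u\<^sup>2) (v\<^sup>2)"
    and "d = 1673196525 * v ^ 25" and "e = 27 * (v\<^sup>2 - u\<^sup>2)"
  have c: "v > 0" "u > 0" "v > u" and lower: "100 * c * d \<le> 693147180559 * m * d + h"
    and upper: "(693147180560 * m * d + h) * e + 2 * 10 ^ 12 * 1673196525 * u ^ 27 \<le> 100 * (c + 2) * d * e"
    using assms unfolding ln_check_def u_def[symmetric] v_def[symmetric] h_def d_def e_def Let_def
    by auto
  have "d > 0" using c by (simp add: d_def)
  have "e > 0" using c by (simp add: e_def power_strict_mono)
  let ?y = "real_of_int u / real_of_int v"
  have series: "artanh_series ?y = h / (10 ^ 12 * d)"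
    using artanh_series_eq_form[OF c(1), of u] by (simp add: h_def d_def)
  have err: "2 * ?y ^ 27 / (27 * (1 - ?y\<^sup>2)) = 2 * 1673196525 * u ^ 27 / (d * e)"
  proof -
    have e1: "1 - ?y\<^sup>2 = (v\<^sup>2 - u\<^sup>2) / v\<^sup>2"
      using c by (simp add: field_simps)
    have e2: "?y ^ 27 = u ^ 27 / (v ^ 25 * v\<^sup>2)"
      by (simp add: power_divide flip: power_add)
    have gen: "2 * (U / (V * W)) / (27 * (D / W)) = 2 * 1673196525 * U / (1673196525 * V * (27 * D))"
      if "W \<noteq> 0" for U V W D :: real
      using that by simp
    show ?thesis unfolding e1 e2 of_int_mult by (subst gen) (use c in \<open>simp_all add: d_def e_def\<close>)
  qed
  have "real_of_int c / 10 ^ 10 \<le> ln (real_of_int p) \<and> ln (real_of_int p) \<le> (real_of_int c + 2) / 10 ^ 10"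
  proof (rule ln_bounds_pow2[where m = m and y = ?y])
    show "2 ^ m < real_of_int p"
      using c(2) unfolding u_def by (simp flip: of_int_power[of 2, simplified])
    show "?y = (real_of_int p - 2 ^ m) / (real_of_int p + 2 ^ m)"
      by (simp add: u_def v_def)
    have "100 * real_of_int c * d \<le> 693147180559 * m * d + h"
      using lower by (simp flip: of_int_le_iff[where 'a = real])
    then show "real_of_int c / 10 ^ 10 \<le> real m * (693147180559 / 10 ^ 12) + artanh_series ?y"
      using \<open>d > 0\<close> unfolding series by (simp add: field_simps)
    have "(693147180560 * m * d + h) * e + 2 * 10 ^ 12 * 1673196525 * u ^ 27 \<le> 100 * (c + 2) * real_of_int d * e"
      using upper by (simp flip: of_int_le_iff[where 'a = real])
    then show "real m * (693147180560 / 10 ^ 12) + artanh_series ?y + 2 * ?y ^ 27 / (27 * (1 - ?y\<^sup>2))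
        \<le> (real_of_int c + 2) / 10 ^ 10"
      using \<open>d > 0\<close> \<open>e > 0\<close> unfolding series err by (simp add: field_simps)
  qed
  then show "c / 10 ^ 10 \<le> ln (real_of_int p)" "ln (real_of_int p) \<le> (c + 2) / 10 ^ 10"
    by simp_all
qed

text \<open>Triples \<open>(c, p, m)\<close> for the first 45 primes \<open>p\<close>:
  \<open>c / 10 ^ 10\<close> approximates \<open>ln p\<close> from below, and \<open>m\<close> is
  the power of two to split off, with 2^m < p \<le> 2^(m+1).\<close>

definition ln_prime_data :: "(int \<times> int \<times> nat) list" where
  "ln_prime_data =
    [(6931471805, 2, 0), (10986122886, 3, 1), (16094379124, 5, 2), (19459101490, 7, 2),
     (23978952727, 11, 3), (25649493574, 13, 3), (28332133440, 17, 4), (29444389791, 19, 4),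
     (31354942159, 23, 4), (33672958299, 29, 4), (34339872044, 31, 4), (36109179126, 37, 5),
     (37135720666, 41, 5), (37612001156, 43, 5), (38501476017, 47, 5), (39702919135, 53, 5),
     (40775374439, 59, 5), (41108738641, 61, 5), (42046926193, 67, 6), (42626798770, 71, 6),
     (42904594411, 73, 6), (43694478524, 79, 6), (44188406077, 83, 6), (44886363697, 89, 6),
     (45747109784, 97, 6), (46151205168, 101, 6), (46347289882, 103, 6), (46728288344, 107, 6),
     (46913478822, 109, 6), (47273878187, 113, 6), (48441870864, 127, 6), (48751973231, 131, 7),
     (49199809258, 137, 7), (49344739331, 139, 7), (50039463059, 149, 7), (50172798368, 151, 7),
     (50562458053, 157, 7), (50937502008, 163, 7), (51179938124, 167, 7), (51532915944, 173, 7),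
     (51873858058, 179, 7), (51984970312, 181, 7), (52522734280, 191, 7), (52626901888, 193, 7),
     (52832037287, 197, 7)]"

definition ln_primes_lower :: "int list" where
  "ln_primes_lower = map fst ln_prime_data"

lemma ln_prime_data_check:
  "list_all (\<lambda>(c, p, m). ln_check c (int m) (p - 2 ^ m) (p + 2 ^ m)) ln_prime_data"
  by code_simp

lemma ln_prime_seq_bounds:
  assumes "i < 45"
  shows "ln_primes_lower ! i / 10 ^ 10 \<le> ln (prime_seq i)"
    and "ln (prime_seq i) \<le> (ln_primes_lower ! i + 2) / 10 ^ 10"
proof -
  obtain c p m where cpm: "ln_prime_data ! i = (c, p, m)" by (cases "ln_prime_data ! i")
  have len: "length ln_prime_data = 45" by (simp add: ln_prime_data_def)
  have "map (fst \<circ> snd) ln_prime_data = map int (take 45 small_primes)"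
    by (simp add: ln_prime_data_def small_primes_def)
  then have "map (fst \<circ> snd) ln_prime_data ! i = map int (take 45 small_primes) ! i"
    by simp
  then have p: "p = int (prime_seq i)"
    using assms cpm len length_small_primes prime_seq_eq_nth[of i] by simp
  have c: "c = ln_primes_lower ! i"
    using assms cpm len by (simp add: ln_primes_lower_def)
  have "ln_check c m (p - 2 ^ m) (p + 2 ^ m)"
    using ln_prime_data_check assms len cpm unfolding list_all_length by fastforce
  from ln_check[OF this] show "ln_primes_lower ! i / 10 ^ 10 \<le> ln (prime_seq i)"
    and "ln (prime_seq i) \<le> (ln_primes_lower ! i + 2) / 10 ^ 10"
    unfolding c p by simp_all
qed

section \<open>At least 45 prime factors\<close>

lemma ln_eq_sum_factorization:
  fixes q a :: "nat \<Rightarrow> nat"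
  assumes "\<And>i. i < k \<Longrightarrow> q i > 0"
  shows "ln (\<Prod>i<k. q i ^ a i) = (\<Sum>i<k. a i * ln (q i))"
  using assms
proof (induction k)
  case (Suc k)
  have "(\<Prod>i<k. real (q i) ^ a i) > 0" using Suc.prems by (intro prod_pos) auto
  then show ?case using Suc by (simp add: ln_mult_pos ln_realpow)
qed simp

text \<open>Arithmetic against geometric mean for the numbers \<open>(a i + 1) * w i\<close>.
  Weights below the logarithms of the primes keep the weighted sum of the exponents below
  \<open>ln n\<close>; they are allowed because large primes are known only through lower bounds.
  The second claim uses that all exponents are at least 1.\<close>

lemma tau_mult_prod_le:
  fixes w :: "nat \<Rightarrow> real"
  assumes "n > 0" "omega n > 0"
    and w: "\<And>i. i < omega n \<Longrightarrow> 0 < w i \<and> w i \<le> ln (prime_seq i)"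
  shows "tau n * (\<Prod>i<omega n. w i) \<le> ((ln n + (\<Sum>i<omega n. w i)) / omega n) ^ omega n"
    and "(\<Sum>i<omega n. w i) \<le> ln n"
proof -
  let ?k = "omega n"
  obtain q a :: "nat \<Rightarrow> nat" where q: "\<And>i. i < ?k \<Longrightarrow> prime_seq i \<le> q i"
    and a: "\<And>i. i < ?k \<Longrightarrow> a i \<ge> 1"
    and n: "n = (\<Prod>i<?k. q i ^ a i)" and tau: "tau n = (\<Prod>i<?k. a i + 1)"
    using factorization_sorted[OF assms(1)] by blast
  have pos: "prime_seq i > 0" for i using prime_prime_seq prime_gt_0_nat by blast
  have "ln n = (\<Sum>i<?k. a i * ln (q i))"
    by (subst n, rule ln_eq_sum_factorization) (use q pos in \<open>force intro: less_le_trans\<close>)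
  moreover have wq: "w i \<le> ln (q i)" if "i < ?k" for i
    using w[OF that] q[OF that] pos[of i] by (smt (verit) ln_le_cancel_iff of_nat_0_less_iff of_nat_mono)
  ultimately have ln: "(\<Sum>i<?k. a i * w i) \<le> ln n"
    by (auto intro!: sum_mono mult_left_mono)
  have "(\<Sum>i<?k. w i) \<le> (\<Sum>i<?k. a i * w i)"
  proof (intro sum_mono)
    fix i assume "i \<in> {..<?k}"
    then show "w i \<le> a i * w i"
      using a[of i] w[of i] mult_right_mono[of 1 "real (a i)" "w i"] by simp
  qed
  then show "(\<Sum>i<?k. w i) \<le> ln n" using ln by simp
  let ?x = "\<lambda>i. (real (a i) + 1) * w i"
  have pos_x: "?x i > 0" if "i < ?k" for i using w[OF that] by (intro mult_pos_pos) auto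
  have "(\<Prod>i<?k. ?x i) = ((\<Prod>i<?k. ?x i) powr (1 / ?k)) ^ ?k"
  proof -
    have root: "P = (P powr (1 / ?k)) ^ ?k" if "P > 0" for P :: real
      using that assms(2) by (simp add: powr_realpow[symmetric] powr_powr)
    have "(\<Prod>i<?k. ?x i) > 0" using pos_x by (intro prod_pos) auto
    then show ?thesis by (rule root)
  qed
  also have "\<dots> \<le> (\<Sum>i<?k. ?x i / ?k) ^ ?k"
    using arith_geom_mean[of "{..<?k}" ?x] assms(2) pos_x
    by (intro power_mono) (auto simp: less_imp_le)
  also have "(\<Sum>i<?k. ?x i / ?k) = ((\<Sum>i<?k. a i * w i) + (\<Sum>i<?k. w i)) / ?k"
    by (simp add: sum_divide_distrib sum.distrib[symmetric] add_divide_distrib[symmetric] distrib_right)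
  also have "\<dots> ^ ?k \<le> ((ln n + (\<Sum>i<?k. w i)) / ?k) ^ ?k"
    using ln w by (intro power_mono divide_right_mono divide_nonneg_nonneg add_nonneg_nonneg sum_nonneg)
      (auto simp: less_imp_le)
  finally show "tau n * (\<Prod>i<?k. w i) \<le> ((ln n + (\<Sum>i<?k. w i)) / ?k) ^ ?k"
    by (simp add: tau prod.distrib add.commute)
qed

text \<open>Chains \<open>lambda n \<ge> 1\<close> with the inequality of the means, takes
  \<open>k\<close>-th roots and multiplies by \<open>k * ln k\<close>. The result is linear in
  \<open>ln n\<close>, and it bounds \<open>ln n\<close> from above as soon as
  \<open>c > ln k\<close>.\<close>

lemma one_le_lambda_imp:
  fixes w :: "nat \<Rightarrow> real"
  assumes "omega n \<ge> 2" "lambda n \<ge> 1"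
    and w: "\<And>i. i < omega n \<Longrightarrow> 0 < w i \<and> w i \<le> ln (prime_seq i)"
    and c: "c > 0" "c ^ omega n \<le> (\<Prod>i<omega n. w i)"
  shows "c * (ln n + omega n * ln (omega n)) \<le> ln (omega n) * (ln n + (\<Sum>i<omega n. w i))"
proof -
  let ?k = "omega n"
  have "n > 1"
  proof (rule ccontr)
    assume "\<not> n > 1"
    then have "n = 0 \<or> n = 1" by auto
    \<comment> \<open>\<open>prime_factors 0\<close> is empty by convention, so \<open>omega\<close>
      vanishes at 0 as it does at 1.\<close>
    then show False using assms(1) by (auto simp: omega_def)
  qed
  have W: "real ?k * ln ?k > 0" using assms(1) by simp
  have "((1 + ln n / (?k * ln ?k)) * c) ^ ?k \<le> tau n * (\<Prod>i<?k. w i)"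
    using one_le_lambda_iff[OF \<open>n > 1\<close> assms(1)] assms(2) c unfolding power_mult_distrib
    by (intro mult_mono) auto
  also have "\<dots> \<le> ((ln n + (\<Sum>i<?k. w i)) / ?k) ^ ?k"
    using \<open>n > 1\<close> assms(1) w by (intro tau_mult_prod_le) auto
  finally have "(1 + ln n / (?k * ln ?k)) * c \<le> (ln n + (\<Sum>i<?k. w i)) / ?k"
  proof -
    have "0 \<le> (ln n + (\<Sum>i<?k. w i)) / ?k"
      using \<open>n > 1\<close> w by (intro divide_nonneg_nonneg add_nonneg_nonneg sum_nonneg) (auto simp: less_imp_le)
    moreover assume "((1 + ln n / (?k * ln ?k)) * c) ^ ?k \<le> ((ln n + (\<Sum>i<?k. w i)) / ?k) ^ ?k"
    moreover have "0 \<le> (1 + ln n / (?k * ln ?k)) * c"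
      using assms(1) c \<open>n > 1\<close> by (intro mult_nonneg_nonneg add_nonneg_nonneg divide_nonneg_nonneg) auto
    ultimately show ?thesis using assms(1) by (subst (asm) power_mono_iff) auto
  qed
  then have "(1 + ln n / (?k * ln ?k)) * c * (?k * ln ?k) \<le> (ln n + (\<Sum>i<?k. w i)) / ?k * (?k * ln ?k)"
    using W by (intro mult_right_mono) auto
  moreover have "(1 + ln n / (?k * ln ?k)) * c * (?k * ln ?k) = c * (ln n + ?k * ln ?k)"
  proof -
    have "(1 + x / V) * c * V = c * (x + V)" if "V > 0" for x V :: real
      using that by (simp add: field_simps)
    then show ?thesis using W by blast
  qed
  moreover have "(ln n + (\<Sum>i<?k. w i)) / ?k * (?k * ln ?k) = ln ?k * (ln n + (\<Sum>i<?k. w i))"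
    using assms(1) by simp
  ultimately show ?thesis by simp
qed

section \<open>Weights below the logarithms of the primes, and their elementary estimates\<close>

text \<open>The density \<open>8 / 35 = 48 / 210\<close> is that of the residues coprime to \<open>210\<close>.\<close>

definition ln_weight :: "nat \<Rightarrow> real" where
  "ln_weight i = (if i < 45 then ln (prime_seq i) else ln (35 / 8 * i))"

lemma ln_weight_bounds: "0 < ln_weight i" "ln_weight i \<le> ln (prime_seq i)"
proof -
  have "prime_seq i \<ge> 2" using prime_prime_seq prime_ge_2_nat by blast
  moreover have "35 / 8 * real i \<le> prime_seq i" if "i \<ge> 45"
    using prime_seq_lower[OF that] by linarith
  ultimately show "0 < ln_weight i" "ln_weight i \<le> ln (prime_seq i)"
    by (auto simp: ln_weight_def)
qed

lemma ln_small_bounds: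
  "(693147 / 1000000) \<le> ln (2::real)" "ln (2::real) \<le> (693148 / 1000000)"
  "(1098612 / 1000000) \<le> ln (3::real)" "ln (3::real) \<le> (1098613 / 1000000)"
  "(1609437 / 1000000) \<le> ln (5::real)" "ln (5::real) \<le> (1609438 / 1000000)"
  "(1945910 / 1000000) \<le> ln (7::real)" "ln (7::real) \<le> (1945911 / 1000000)"
  "(2564949 / 1000000) \<le> ln (13::real)" "ln (17::real) \<le> (2833214 / 1000000)"
  using ln_prime_seq_bounds[of 0] ln_prime_seq_bounds[of 1] ln_prime_seq_bounds[of 2]
    ln_prime_seq_bounds[of 3] ln_prime_seq_bounds[of 5] ln_prime_seq_bounds[of 6]
  by (simp_all add: prime_seq_eq_nth small_primes_def ln_primes_lower_def ln_prime_data_def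
      del: enumerate_0 enumerate_Suc)

text \<open>The end points of the ranges of \<open>k\<close> have no prime factors other than 2, 3,
  5, 13 and 17, so the preceding bounds give their logarithms.\<close>

lemma ln_prod_numerals:
  "ln 45 = 2 * ln 3 + ln (5::real)" "ln 51 = ln 3 + ln (17::real)"
  "ln 52 = 2 * ln 2 + ln (13::real)" "ln 108 = 2 * ln 2 + 3 * ln (3::real)"
  "ln 400 = 4 * ln 2 + 2 * ln (5::real)" "ln 600 = 3 * ln 2 + ln 3 + 2 * ln (5::real)"
  "ln (35 / 8) = ln 5 + ln 7 - 3 * ln (2::real)"
proof -
  have *: "ln (x ^ 2 * y) = 2 * ln x + ln y" "ln (x ^ 3 * y) = 3 * ln x + ln y"
    "ln (x ^ 4 * y) = 4 * ln x + ln y" "ln (x * y) = ln x + ln y" "ln (x ^ 2) = 2 * ln x"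
    "ln (x ^ 3) = 3 * ln x"
    if "x > 0" "y > 0" for x y :: real using that by (simp_all add: ln_mult_pos ln_realpow)
  show "ln 45 = 2 * ln 3 + ln (5::real)" using *(1)[of 3 5] by simp
  show "ln 51 = ln 3 + ln (17::real)" using *(4)[of 3 17] by simp
  show "ln 52 = 2 * ln 2 + ln (13::real)" using *(1)[of 2 13] by simp
  show "ln 108 = 2 * ln 2 + 3 * ln (3::real)" using *(1)[of 2 27] *(6)[of 3 1] by simp
  show "ln 400 = 4 * ln 2 + 2 * ln (5::real)" using *(3)[of 2 25] *(5)[of 5 1] by simp
  show "ln 600 = 3 * ln 2 + ln 3 + 2 * ln (5::real)"
    using *(2)[of 2 75] *(4)[of 3 25] *(5)[of 5 1] by simp
  show "ln (35 / 8) = ln 5 + ln 7 - 3 * ln (2::real)"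
    using *(4)[of 5 7] *(6)[of 2 1] ln_div[of 35 8] by simp
qed

lemma ln_weight_large:
  assumes "k \<ge> 45"
  shows "ln k + (1475 / 1000) \<le> ln_weight k" "ln_weight k \<le> ln k + (1476 / 1000)"
proof -
  have "ln_weight k = ln (35 / 8 * real k)"
    using assms by (simp add: ln_weight_def)
  also have "\<dots> = ln (35 / 8) + ln k"
    using assms by (intro ln_mult_pos) auto
  finally show "ln k + (1475 / 1000) \<le> ln_weight k" "ln_weight k \<le> ln k + (1476 / 1000)"
    using ln_small_bounds ln_prod_numerals(7) by linarith+
qed

lemma ln_Suc_bounds:
  assumes "k > 0"
  shows "1 / (real k + 1) \<le> ln (Suc k) - ln k" "ln (Suc k) - ln k \<le> 1 / k"
proof -
  have "ln (Suc k) - ln k = ln (Suc k / k)"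
    using assms by (simp add: ln_div)
  also have "Suc k / k = 1 + 1 / real k"
    using assms by (simp add: field_simps)
  finally show "ln (Suc k) - ln k \<le> 1 / k"
    using ln_add_one_self_le_self[of "1 / k"] by simp
  have "ln k - ln (Suc k) = ln (k / (k + 1))"
    using assms by (simp add: ln_div add.commute)
  also have "\<dots> \<le> k / (k + 1) - 1"
    using assms by (intro ln_le_minus_one) simp
  also have "\<dots> = - (1 / (real k + 1))" by (simp add: field_simps)
  finally show "1 / (real k + 1) \<le> ln (Suc k) - ln k" by simp
qed

lemma length_ln_primes_lower: "length ln_primes_lower = 45"
  by (simp add: ln_primes_lower_def ln_prime_data_def)

lemma ln_primes_lower_pos: "i < 45 \<Longrightarrow> ln_primes_lower ! i > 0"
proof -
  have "list_all (\<lambda>c. c > 0) ln_primes_lower" by (simp add: ln_primes_lower_def ln_prime_data_def)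
  then show "i < 45 \<Longrightarrow> ln_primes_lower ! i > 0"
    by (simp add: list_all_length length_ln_primes_lower)
qed

text \<open>Reduces combinations of logarithms to integer arithmetic on the table. Each logarithm is
  known up to 2 / 10^10, whence the term \<open>2 * sum_list bs\<close>.\<close>

lemma weighted_sum_ln_prime_bounds:
  fixes bs :: "int list"
  assumes "length bs \<le> 45" "list_all (\<lambda>b. b \<ge> 0) bs"
  shows "sum_list (map2 (*) bs ln_primes_lower) / 10 ^ 10 \<le> (\<Sum>i<length bs. bs ! i * ln (prime_seq i))"
    and "(\<Sum>i<length bs. bs ! i * ln (prime_seq i)) \<le>
      (sum_list (map2 (*) bs ln_primes_lower) + 2 * sum_list bs) / 10 ^ 10"
proof -
  let ?c = "\<lambda>i. ln_primes_lower ! i"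
  have b: "bs ! i \<ge> 0" if "i < length bs" for i using assms(2) that by (simp add: list_all_length)
  have S: "sum_list (map2 (*) bs ln_primes_lower) = (\<Sum>i<length bs. bs ! i * ?c i)"
    using assms(1) by (simp add: sum_list_sum_nth length_ln_primes_lower lessThan_atLeast0)
  have T: "sum_list bs = (\<Sum>i<length bs. bs ! i)"
    by (simp add: sum_list_sum_nth lessThan_atLeast0)
  have "(\<Sum>i<length bs. bs ! i * (?c i / 10 ^ 10)) \<le> (\<Sum>i<length bs. bs ! i * ln (prime_seq i))"
    using ln_prime_seq_bounds(1) assms(1) b by (intro sum_mono mult_left_mono) auto
  then show "sum_list (map2 (*) bs ln_primes_lower) / 10 ^ 10 \<le> (\<Sum>i<length bs. bs ! i * ln (prime_seq i))"
    unfolding S by (simp add: sum_divide_distrib)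
  have "(\<Sum>i<length bs. bs ! i * ln (prime_seq i)) \<le> (\<Sum>i<length bs. bs ! i * ((?c i + 2) / 10 ^ 10))"
    using ln_prime_seq_bounds(2) assms(1) b by (intro sum_mono mult_left_mono) auto
  then show "(\<Sum>i<length bs. bs ! i * ln (prime_seq i)) \<le>
      (sum_list (map2 (*) bs ln_primes_lower) + 2 * sum_list bs) / 10 ^ 10"
    unfolding S T by (simp add: sum_divide_distrib sum_distrib_left sum.distrib[symmetric]
        add_divide_distrib distrib_left mult_ac)
qed

lemma prod_ln_prime_ge:
  fixes c :: int
  assumes "m \<le> 45" "c ^ m \<le> prod_list (take m ln_primes_lower)"
  shows "(c / 10 ^ 10) ^ m \<le> (\<Prod>i<m. ln (prime_seq i))"
proof -
  have "prod_list (take m ln_primes_lower) = (\<Prod>i<m. ln_primes_lower ! i)"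
    using assms(1) by (simp add: prod.list_conv_set_nth length_ln_primes_lower lessThan_atLeast0)
  then have "real_of_int c ^ m \<le> (\<Prod>i<m. real_of_int (ln_primes_lower ! i))"
    using assms(2) by (metis of_int_le_iff of_int_power of_int_prod)
  then have "(c / 10 ^ 10) ^ m \<le> (\<Prod>i<m. real_of_int (ln_primes_lower ! i)) / (10 ^ 10) ^ m"
    unfolding power_divide by (intro divide_right_mono) auto
  also have "\<dots> = (\<Prod>i<m. ln_primes_lower ! i / 10 ^ 10)"
    by (simp only: prod_dividef prod_constant card_lessThan)
  also have "\<dots> \<le> (\<Prod>i<m. ln (prime_seq i))"
    using ln_prime_seq_bounds(1) ln_primes_lower_pos assms(1)
    by (intro prod_mono) (simp add: less_imp_le)
  finally show ?thesis .
qed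

section \<open>Arithmetic and geometric means of the weights\<close>

lemma sum_ln_weight_45:
  "(\<Sum>i<45. ln_weight i) \<ge> 183" "(\<Sum>i<45. ln_weight i) \<le> 184"
proof -
  have "1830000000000 \<le> sum_list (map2 (*) (replicate 45 1) ln_primes_lower)"
    "sum_list (map2 (*) (replicate 45 1) ln_primes_lower) + 2 * sum_list (replicate 45 1) \<le> 1840000000000"
    by code_simp+
  moreover have "(\<Sum>i<45. ln_weight i) = (\<Sum>i<length (replicate 45 (1::int)). replicate 45 (1::int) ! i * ln (prime_seq i))"
    by (simp add: ln_weight_def)
  moreover have "list_all (\<lambda>b. b \<ge> 0) (replicate 45 (1::int))" by (simp add: list_all_iff)
  ultimately show "(\<Sum>i<45. ln_weight i) \<ge> 183" "(\<Sum>i<45. ln_weight i) \<le> 184"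
    using weighted_sum_ln_prime_bounds[of "replicate 45 1"] by simp_all
qed

text \<open>By induction. From k to k + 1 the term \<open>k * ln k\<close> grows by ln k + (k + 1)
  d, where d = ln (k + 1) - ln k and (k + 1) d lies between 1 and 1 + 1/45, while the new weight
  lies between ln k + 1.475 and ln k + 1.476. Thus the lower bound gains, and 476/1000 = 1.476 - 1
  is what the upper bound requires.\<close>

lemma sum_ln_weight_bounds:
  assumes "k \<ge> 45"
  shows "k * ln k \<le> (\<Sum>i<k. ln_weight i)" "(\<Sum>i<k. ln_weight i) \<le> k * (ln k + (476 / 1000))"
proof -
  have "k * ln k \<le> (\<Sum>i<k. ln_weight i) \<and> (\<Sum>i<k. ln_weight i) \<le> k * (ln k + (476 / 1000))"
    using assms
  proof (induction k rule: dec_induct)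
    case base
    then show ?case using sum_ln_weight_45 ln_small_bounds ln_prod_numerals(1) by simp
  next
    case (step k)
    define d where "d = ln (Suc k) - ln k"
    have k: "k > 0" using step by simp
    have d: "1 \<le> (real k + 1) * d" "real k * d \<le> 1" "d \<le> 1 / 45"
    proof -
      show "1 \<le> (real k + 1) * d" "real k * d \<le> 1"
        using ln_Suc_bounds[OF k] k unfolding d_def by (simp_all add: field_simps)
      have "d \<le> 1 / k" using ln_Suc_bounds[OF k] by (simp add: d_def)
      also have "\<dots> \<le> 1 / 45" using step by (intro divide_left_mono) auto
      finally show "d \<le> 1 / 45" .
    qed
    have ln: "ln (Suc k) = ln k + d" by (simp add: d_def)
    have "real (Suc k) * (ln k + d) = k * ln k + ln k + (real k + 1) * d"
      "real (Suc k) * (ln k + d + (476 / 1000)) = k * (ln k + (476 / 1000)) + ln k + (real k + 1) * d + (476 / 1000)"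
      "(real k + 1) * d = real k * d + d"
      by (simp_all add: algebra_simps)
    then show ?case unfolding ln sum.lessThan_Suc
      using step.IH ln_weight_large[OF step.hyps(1)] d by linarith
  qed
  then show "k * ln k \<le> (\<Sum>i<k. ln_weight i)" "(\<Sum>i<k. ln_weight i) \<le> k * (ln k + (476 / 1000))"
    by auto
qed

text \<open>Induction step for bounds of the form \<open>F ^ k \<le> P\<close> whose base grows by
  at most m / k: replacing F by F + m / k multiplies the \<open>k\<close>-th power by (1 + (m / F) /
  k)^k \<le> exp (m / F), and \<open>x\<close> is the next factor of the product.\<close>

lemma power_Suc_le_step:
  fixes F F' m P x :: real
  assumes "F > 0" "F' \<ge> 0" "m \<ge> 0" "k > 0" "F' \<le> F + m / k" "(F + m / k) * exp (m / F) \<le> x" "F ^ k \<le> P"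
  shows "F' ^ Suc k \<le> P * x"
proof -
  have "F' ^ Suc k \<le> (F + m / k) ^ Suc k" using assms by (intro power_mono) auto
  also have "\<dots> = (F + m / k) * (F * (1 + m / F / k)) ^ k"
  proof -
    have "F + m / k = F * (1 + m / F / k)" using assms by (simp add: field_simps)
    then show ?thesis by (simp only: power_Suc)
  qed
  also have "\<dots> = F ^ k * ((F + m / k) * (1 + m / F / k) ^ k)"
    by (simp only: power_mult_distrib mult_ac)
  also have "\<dots> \<le> F ^ k * ((F + m / k) * exp (m / F))"
  proof (intro mult_left_mono)
    have "0 \<le> m / F" using assms by simp
    then have "- real k \<le> m / F" by linarith
    then show "(1 + m / F / k) ^ k \<le> exp (m / F)"
      using assms by (intro exp_ge_one_plus_x_over_n_power_n) auto
  qed (use assms in auto)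
  also have "\<dots> \<le> P * x"
    using assms order_trans[OF zero_le_power assms(7)] by (intro mult_mono) auto
  finally show ?thesis .
qed

lemma exp_le_cubic:
  fixes z :: real
  assumes "0 \<le> z" "z \<le> 3/10"
  shows "exp z \<le> 1 + z + z\<^sup>2 / 2 + z ^ 3 / 4"
proof -
  obtain t where t: "\<bar>t\<bar> \<le> \<bar>z\<bar>" "exp z = (\<Sum>m<3. z ^ m / fact m) + exp t / fact 3 * z ^ 3"
    using Maclaurin_exp_le[of z 3] by blast
  have "exp t \<le> exp (3/10)" using t assms by simp
  also have "\<dots> \<le> 1 + 3/10 + (3/10)\<^sup>2" by (rule exp_bound) auto
  finally have "exp t / 6 * z ^ 3 \<le> 1 / 4 * z ^ 3"
    using assms by (intro mult_right_mono) (auto simp: power2_eq_square)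
  then show ?thesis using t(2) by (simp add: eval_nat_numeral fact_numeral)
qed

lemma prod_ln_weight_45: "(38156 / 10000) ^ 45 \<le> (\<Prod>i<45. ln_weight i)"
proof -
  have "38156000000 ^ 45 \<le> prod_list (take 45 ln_primes_lower)" by code_simp
  then have "(real_of_int 38156000000 / 10 ^ 10) ^ 45 \<le> (\<Prod>i<45. ln (prime_seq i))"
    by (rule prod_ln_prime_ge[rotated]) simp
  moreover have "real_of_int 38156000000 / 10 ^ 10 = 38156 / 10000" by simp
  moreover have "(\<Prod>i<45. ln (prime_seq i)) = (\<Prod>i<45. ln_weight i)"
    by (intro prod.cong) (auto simp: ln_weight_def)
  ultimately show ?thesis by (simp only:)
qed

text \<open>The slope 109/100 lets the bound for the geometric mean pull away from
  \<open>ln k\<close>: its excess is 0.0089 at k = 45, where the constant 3337/10000 fits the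
  computed product, and 0.242 at k = 600.\<close>

lemma prod_ln_weight_mid:
  assumes "k \<ge> 45" "k \<le> 600"
  shows "((109 / 100) * ln k - (3337 / 10000)) ^ k \<le> (\<Prod>i<k. ln_weight i)"
  using assms
proof (induction k rule: dec_induct)
  case base
  have "((109 / 100) * ln 45 - (3337 / 10000)) ^ 45 \<le> ((38156 / 10000) :: real) ^ 45"
    using ln_small_bounds ln_prod_numerals(1) by (intro power_mono; linarith)
  then show ?case using prod_ln_weight_45 by simp
next
  case (step k)
  define t where "t = (109 / 100) * ln k - (3337 / 10000)"
  have "ln 45 \<le> ln (real k)" "ln (real k) \<le> ln 600" using step by simp_all
  then have t: "(381 / 100) \<le> t" "t \<le> (665 / 100)"
    using ln_small_bounds ln_prod_numerals unfolding t_def by simp_all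
  define r where "r = 1 / t"
  have r: "r * t = 1" "0 < r" "r \<le> (2625 / 10000)"
    using t by (simp_all add: r_def field_simps)
  \<comment> \<open>Here 59405/100000 and 32375725/100000000 in the next lines are 1.09^2 / 2 and
    1.09^3 / 4.\<close>
  have "exp ((109 / 100) / t) \<le> 1 + (109 / 100) / t + ((109 / 100) / t)\<^sup>2 / 2 + ((109 / 100) / t) ^ 3 / 4"
    using t by (intro exp_le_cubic) (auto simp: field_simps)
  also have "\<dots> = 1 + (109 / 100) * r + (59405 / 100000) * r\<^sup>2 + (32375725 / 100000000) * r ^ 3"
    by (simp add: r_def power_divide)
  finally have exp_r: "exp ((109 / 100) / t) \<le> 1 + (109 / 100) * r + (59405 / 100000) * r\<^sup>2 + (32375725 / 100000000) * r ^ 3" .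
  have r2: "r\<^sup>2 \<le> (2625 / 10000) * r" using r by (simp add: power2_eq_square)
  have r3: "r ^ 3 \<le> (2625 / 10000) * r\<^sup>2"
    using r mult_right_mono[of r "2625 / 10000" "r\<^sup>2"] by (simp add: power3_eq_cube power2_eq_square mult_ac)
  have "(t + (109 / 100) / k) * exp ((109 / 100) / t) \<le> ln_weight k"
  proof -
    have "t * exp ((109 / 100) / t) \<le> t * (1 + (109 / 100) * r + (59405 / 100000) * r\<^sup>2 + (32375725 / 100000000) * r ^ 3)"
      using t exp_r by (intro mult_left_mono) auto
    also have "\<dots> = t + (r * t) * ((109 / 100) + (59405 / 100000) * r + (32375725 / 100000000) * r\<^sup>2)"
      by (simp add: algebra_simps power2_eq_square power3_eq_cube)
    also have "\<dots> \<le> t + (109 / 100) + (6791 / 10000) * r" using r r2 by simp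
    finally have 1: "t * exp ((109 / 100) / t) \<le> t + (109 / 100) + (6791 / 10000) * r" .
    have "exp ((109 / 100) / t) \<le> (134 / 100)" using exp_r r r2 r3 by simp
    moreover have "(109 / 100) / k \<le> (2423 / 100000)" using step.hyps by (simp add: field_simps)
    ultimately have 2: "(109 / 100) / k * exp ((109 / 100) / t) \<le> (2423 / 100000) * (134 / 100)" by (intro mult_mono) auto
    \<comment> \<open>Multiplied out, this bounds the convex function 1/t by its chord over the
      range [3.81, 6.65] of t, so that the remaining inequality is linear.\<close>
    have "0 \<le> r * ((t - (381 / 100)) * ((665 / 100) - t))" using r t by (intro mult_nonneg_nonneg) auto
    also have "\<dots> = (1046 / 100) * (r * t) - t * (r * t) - (253365 / 10000) * r" by (simp add: field_simps)
    finally have "(253365 / 10000) * r \<le> (1046 / 100) - t" using r by simp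
    moreover have "ln k + (1475 / 1000) \<le> ln_weight k" using step.hyps by (intro ln_weight_large) auto
    ultimately show ?thesis using 1 2 t unfolding t_def[symmetric] distrib_right
      by (simp add: t_def)
  qed
  moreover have "(109 / 100) * ln (Suc k) - (3337 / 10000) \<le> t + (109 / 100) / k" "(109 / 100) * ln (Suc k) - (3337 / 10000) \<ge> t"
    using ln_Suc_bounds[of k] step.hyps by (simp_all add: t_def)
  moreover have "t ^ k \<le> (\<Prod>i<k. ln_weight i)" using step by (simp add: t_def)
  ultimately have "((109 / 100) * ln (Suc k) - (3337 / 10000)) ^ Suc k \<le> (\<Prod>i<k. ln_weight i) * ln_weight k"
    using t step.hyps by (intro power_Suc_le_step[where F = t and m = "109 / 100"]) auto
  then show ?case by (simp only: prod.lessThan_Suc)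
qed

text \<open>From 600 on a constant excess over \<open>ln k\<close> suffices. The value 0.24 is just
  over half of 0.476, the excess in the upper bound for the arithmetic mean, and this makes the
  final contradiction work.\<close>

lemma prod_ln_weight_large:
  assumes "k \<ge> 600"
  shows "(ln k + (24 / 100)) ^ k \<le> (\<Prod>i<k. ln_weight i)"
  using assms
proof (induction k rule: dec_induct)
  case base
  have "(ln 600 + (24 / 100)) ^ 600 \<le> ((109 / 100) * ln 600 - (3337 / 10000) :: real) ^ 600"
    using ln_small_bounds ln_prod_numerals(6) by (intro power_mono; linarith)
  then show ?case using prod_ln_weight_mid[of 600] by simp
next
  case (step k)
  define t where "t = ln k + (24 / 100)"
  have "ln 600 \<le> ln (real k)" using step by simp
  then have t: "(66 / 10) \<le> t"
    using ln_small_bounds ln_prod_numerals(6) unfolding t_def by simp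
  define r where "r = 1 / t"
  have r: "r * t = 1" "0 < r" "r \<le> (152 / 1000)"
    using t by (simp_all add: r_def field_simps)
  have exp_r: "exp (1 / t) \<le> 1 + r + r\<^sup>2"
    unfolding r_def[symmetric] using r by (intro exp_bound) auto
  have r2: "r\<^sup>2 \<le> (152 / 1000) * r" using r by (simp add: power2_eq_square)
  have "(t + 1 / k) * exp (1 / t) \<le> ln_weight k"
  proof -
    have "t * exp (1 / t) \<le> t * (1 + r + r\<^sup>2)"
      using t exp_r by (intro mult_left_mono) auto
    also have "\<dots> = t + (r * t) * (1 + r)"
      by (simp add: algebra_simps power2_eq_square)
    finally have 1: "t * exp (1 / t) \<le> t + 1 + r" using r by simp
    have "exp (1 / t) \<le> (12 / 10)" using exp_r r r2 by simp
    moreover have "1 / k \<le> 1 / 600" using step.hyps by (simp add: field_simps)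
    ultimately have 2: "1 / k * exp (1 / t) \<le> 1 / 600 * (12 / 10)" by (intro mult_mono) auto
    moreover have "ln k + (1475 / 1000) \<le> ln_weight k" using step.hyps by (intro ln_weight_large) auto
    ultimately show ?thesis using 1 2 r unfolding distrib_right by (simp add: t_def)
  qed
  moreover have "ln (Suc k) + (24 / 100) \<le> t + 1 / k" "ln (Suc k) + (24 / 100) \<ge> t"
    using ln_Suc_bounds[of k] step.hyps by (simp_all add: t_def)
  moreover have "t ^ k \<le> (\<Prod>i<k. ln_weight i)" using step by (simp add: t_def)
  ultimately have "(ln (Suc k) + (24 / 100)) ^ Suc k \<le> (\<Prod>i<k. ln_weight i) * ln_weight k"
    using t step.hyps by (intro power_Suc_le_step[where F = t and m = 1]) auto
  then show ?case by (simp only: prod.lessThan_Suc)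
qed

section \<open>The bound for \<open>ln n\<close> when \<open>k \<ge> 45\<close>\<close>

text \<open>If the geometric mean of the weights is at least ln k + s, then s (ln n + W) \<le> 0.476
  W with W = k ln k. For \<open>k \<ge> 600\<close> this contradicts ln n \<ge> W, as 2 * 0.24 >
  0.476. For smaller k it gives ln n \<le> (0.476 / s - 1) W. The number 10640 lies just below ln
  n_star = 10640.84...\<close>

lemma ln_less_if_omega_ge_45:
  assumes "omega n \<ge> 45" "lambda n \<ge> 1"
  shows "ln n < 10640"
proof (rule ccontr)
  assume "\<not> ln n < 10640"
  define k where "k = omega n"
  define W where "W = k * ln k"
  have k: "k \<ge> 45" using assms by (simp add: k_def)
  have n: "n > 0" using assms by (cases n) (auto simp: omega_def)
  have bound: "(c - ln k) * (ln n + W) \<le> (476 / 1000) * W" if "c > 0" "c ^ k \<le> (\<Prod>i<k. ln_weight i)" for c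
  proof -
    have "c * (ln n + W) \<le> ln k * (ln n + (\<Sum>i<k. ln_weight i))"
      using one_le_lambda_imp[of n ln_weight c] assms that ln_weight_bounds k
      by (simp add: k_def W_def)
    also have "\<dots> \<le> ln k * (ln n + k * (ln k + (476 / 1000)))"
      using sum_ln_weight_bounds[OF k] k by (intro mult_left_mono) auto
    finally show ?thesis by (simp add: W_def algebra_simps)
  qed
  have "W > 0" using k by (simp add: W_def)
  have "ln n \<ge> (\<Sum>i<k. ln_weight i)"
    using tau_mult_prod_le(2)[of n ln_weight] n k ln_weight_bounds by (simp add: k_def)
  then have L: "ln n \<ge> W" using sum_ln_weight_bounds[OF k] by (simp add: W_def)
  show False
  proof (cases "k \<ge> 600")
    case True
    have "(24 / 100) * (ln n + W) \<le> (476 / 1000) * W"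
      using bound[of "ln k + (24 / 100)"] prod_ln_weight_large[OF True] k by (simp add: add_pos_nonneg)
    then show False using L \<open>W > 0\<close> by simp
  next
    case False
    have k45: "ln 45 \<le> ln (real k)" using k by simp
    have "(109 / 100) * ln k - (3337 / 10000) > 0"
      using k45 ln_small_bounds ln_prod_numerals(1) by simp
    then have B: "((9 / 100) * ln k - (3337 / 10000)) * (ln n + W) \<le> (476 / 1000) * W"
      using bound[of "(109 / 100) * ln k - (3337 / 10000)"] prod_ln_weight_mid[OF k] False by (simp add: algebra_simps)
    \<comment> \<open>On a range [a, b] of k the excess s is smallest at a and W is largest at b, so
      each range needs only one numerical comparison.\<close>
    have contra: False if "a \<le> k" "k \<le> b" "0 < s" "s \<le> (9 / 100) * ln a - (3337 / 10000)" "b * ln b \<le> w" "0 < a"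
      "((476 / 1000) - s) * w < s * 10640" "s < (476 / 1000)" for a b s w :: real
    proof -
      have "ln a \<le> ln k" using that by simp
      then have "s \<le> (9 / 100) * ln k - (3337 / 10000)" using that by linarith
      then have "s * (ln n + W) \<le> ((9 / 100) * ln k - (3337 / 10000)) * (ln n + W)"
        using L \<open>W > 0\<close> by (intro mult_right_mono) auto
      also note B
      finally have "s * ln n \<le> ((476 / 1000) - s) * W" by (simp add: algebra_simps)
      also have "((476 / 1000) - s) * W \<le> ((476 / 1000) - s) * w"
      proof -
        have "W \<le> b * ln b" unfolding W_def using that k by (intro mult_mono) auto
        then show ?thesis using that by (intro mult_left_mono) auto
      qed
      also have "\<dots> < s * 10640" by fact
      finally have "s * ln n < s * 10640" .
      then show False using that \<open>\<not> ln n < 10640\<close> by simp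
    qed
    \<comment> \<open>The first range is short because the excess is tiny there. As k is an integer,
      nothing is lost between 51 and 52.\<close>
    consider "k \<le> 51" | "52 \<le> k" "k \<le> 108" | "108 \<le> k" "k \<le> 400" | "400 \<le> k" "k \<le> 600"
      using False by linarith
    then show False
    proof cases
      case 1
      then have "45 \<le> real k" "real k \<le> 51" using k by simp_all
      then show ?thesis
        by (rule contra[where s = "889 / 100000" and w = "2006 / 10"])
          (use ln_small_bounds ln_prod_numerals in \<open>linarith | simp\<close>)+
    next
      case 2
      then have "52 \<le> real k" "real k \<le> 108" using k by simp_all
      then show ?thesis
        by (rule contra[where s = "218 / 10000" and w = "506"])
          (use ln_small_bounds ln_prod_numerals in \<open>linarith | simp\<close>)+
    next
      case 3
      then have "108 \<le> real k" "real k \<le> 400" using k by simp_all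
      then show ?thesis
        by (rule contra[where s = "8765 / 100000" and w = "2397"])
          (use ln_small_bounds ln_prod_numerals in \<open>linarith | simp\<close>)+
    next
      case 4
      then have "400 \<le> real k" "real k \<le> 600" using k by simp_all
      then show ?thesis
        by (rule contra[where s = "205 / 1000" and w = "3840"])
          (use ln_small_bounds ln_prod_numerals in \<open>linarith | simp\<close>)+
    qed
  qed
qed

section \<open>Exactly 44 prime factors\<close>

lemma omega_tau_prod_prime_powers:
  fixes q a :: "nat \<Rightarrow> nat"
  assumes q: "inj_on q {..<k}" "\<And>i. i < k \<Longrightarrow> prime (q i)" and a: "\<And>i. i < k \<Longrightarrow> a i \<ge> 1"
  defines "n \<equiv> (\<Prod>i<k. q i ^ a i)"
  shows "n > 0" "omega n = k" "tau n = (\<Prod>i<k. a i + 1)"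
proof -
  let ?S = "q ` {..<k}"
  define f where "f p = a (the_inv_into {..<k} q p)" for p
  have f: "f (q i) = a i" if "i < k" for i
    using that q(1) by (simp add: f_def the_inv_into_f_f)
  have n: "n = (\<Prod>p\<in>?S. p ^ f p)"
    unfolding n_def by (subst prod.reindex[OF q(1)]) (auto simp: f intro!: prod.cong)
  have mult: "multiplicity p n = (if p \<in> ?S then f p else 0)" if "prime p" for p
    unfolding n using that q(2) by (intro multiplicity_prod_prime_powers) auto
  show "n > 0" unfolding n_def using q(2) by (auto intro!: prod_pos simp: prime_gt_0_nat)
  have S: "prime_factors n = ?S"
  proof -
    have "prime_factors n = {p. prime p \<and> 0 < multiplicity p n}"
      by (simp add: prime_factors_multiplicity)
    also have "\<dots> = ?S"
    proof (intro equalityI subsetI)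
      fix p assume "p \<in> {p. prime p \<and> 0 < multiplicity p n}"
      then show "p \<in> ?S" using mult[of p] by (auto split: if_splits)
    next
      fix p assume "p \<in> ?S"
      then obtain i where i: "i < k" "p = q i" by auto
      then have "multiplicity p n = a i" using mult[of p] q(2) f by auto
      then show "p \<in> {p. prime p \<and> 0 < multiplicity p n}" using a[of i] q(2)[of i] i by simp
    qed
    finally show ?thesis .
  qed
  show "omega n = k" unfolding omega_def S using card_image[OF q(1)] by simp
  show "tau n = (\<Prod>i<k. a i + 1)"
    unfolding tau_eq_prod[OF \<open>n > 0\<close>] S
    by (subst prod.reindex[OF q(1)]) (auto simp: mult q(2) f intro!: prod.cong)
qed

section \<open>Tangent bounds for the logarithm of the divisor function\<close>

text \<open>The series 2 artanh (1 / s), since (x - 1) / (x + 1) = 1 / (2j + 1) for x = (j + 1) / j: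
  two terms from below, one term with its remainder from above.\<close>

lemma ln_one_plus_inverse_bounds:
  fixes j :: real
  assumes "j > 0"
  defines "s \<equiv> 2 * j + 1"
  shows "2 / s + 2 / (3 * s ^ 3) \<le> ln ((j + 1) / j)"
    and "ln ((j + 1) / j) \<le> 2 / s + 2 / (3 * s * (s\<^sup>2 - 1))"
proof -
  let ?x = "(j + 1) / j"
  have x: "?x > 1" using assms by simp
  have s: "s > 1" using assms by (simp add: s_def)
  have y: "(?x - 1) / (?x + 1) = 1 / s" using assms by (simp add: s_def field_simps)
  have "(\<Sum>k<2. 2 * (1 / s) ^ (2 * k + 1) / real (2 * k + 1)) = 2 / s + 2 / (3 * s ^ 3)"
    by (simp add: eval_nat_numeral)
  then show "2 / s + 2 / (3 * s ^ 3) \<le> ln ?x"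
    using ln_approx_bounds[OF x, of 2] unfolding y by simp
  have "(1 / s) ^ 3 / (1 - (1 / s)\<^sup>2) = 1 / (s * (s\<^sup>2 - 1))"
  proof -
    have "s\<^sup>2 \<noteq> 1" using s by (simp add: power2_eq_1_iff)
    then show ?thesis using s by (simp add: field_simps power2_eq_square power3_eq_cube)
  qed
  moreover have e: "s * (s\<^sup>2 * 3 - 3) = 3 * (s * (s\<^sup>2 - 1))" by (simp add: algebra_simps)
  ultimately show "ln ?x \<le> 2 / s + 2 / (3 * s * (s\<^sup>2 - 1))"
    using ln_approx_bounds[OF x, of 1] unfolding y by (simp add: e mult.assoc)
qed

text \<open>Concavity of ln (b + 1) along the integers: \<open>y\<close> lies between the increments
  after and before \<open>b\<close>, so it is the slope of a supporting line there. As the increment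
  after \<open>b\<close> falls short of \<open>y\<close> by at least \<open>m\<close>, every step
  upwards loses at least \<open>m\<close> against that line.\<close>

lemma ln_Suc_le_tangent:
  fixes a b :: nat and y m :: real
  assumes "b \<ge> 1" "m \<ge> 0" and up: "ln ((real b + 2) / (real b + 1)) \<le> y - m"
    and down: "y \<le> ln ((real b + 1) / b)"
  shows "ln (real a + 1) \<le> ln (real b + 1) + y * (real a - real b) - (if a > b then m else 0)"
proof (cases "a \<ge> b")
  case True
  have "ln (real (b + d) + 1) \<le> ln (real b + 1) + (y - m) * d" for d
  proof (induction d)
    case (Suc d)
    have "ln (real (b + Suc d) + 1) - ln (real (b + d) + 1) = ln ((real (b + Suc d) + 1) / (real (b + d) + 1))"
      by (simp add: ln_div)
    also have "\<dots> \<le> ln ((real b + 2) / (real b + 1))"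
      by (simp add: field_simps)
    finally show ?case using Suc up by (simp add: algebra_simps)
  qed simp
  from this[of "a - b"] have *: "ln (real a + 1) \<le> ln (real b + 1) + (y - m) * (real a - real b)"
    using True by (simp add: of_nat_diff)
  show ?thesis
  proof (cases "a > b")
    case True
    then have "m * 1 \<le> m * (real a - real b)" using assms by (intro mult_left_mono) auto
    then show ?thesis using * True by (simp add: algebra_simps)
  qed (use * True in simp)
next
  case False
  have "ln (real (b - d) + 1) \<le> ln (real b + 1) - y * d" if "d \<le> b" for d
    using that
  proof (induction d)
    case (Suc d)
    have "ln ((real b + 1) / b) \<le> ln ((real (b - d) + 1) / real (b - d))"
      using Suc.prems assms(1) by (simp add: field_simps of_nat_diff)
    also have "\<dots> = ln (real (b - d) + 1) - ln (real (b - Suc d) + 1)"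
      using Suc.prems by (simp add: ln_div of_nat_diff)
    finally show ?case using Suc down by (simp add: algebra_simps)
  qed simp
  from this[of "b - a"] show ?thesis
    using False by (simp add: of_nat_diff algebra_simps)
qed

text \<open>Integer form of the hypotheses of \<open>ln_Suc_le_tangent\<close> for \<open>y = E / 10 ^ 7 * ln p\<close> and
  \<open>m = M / 10 ^ 17\<close>, where \<open>c / 10 ^ 10\<close> and \<open>(c + 2) / 10 ^ 10\<close> enclose \<open>ln p\<close>.\<close>

definition tangent_check :: "int \<Rightarrow> int \<Rightarrow> int \<Rightarrow> int \<Rightarrow> bool" where
  "tangent_check E M b c \<longleftrightarrow> b \<ge> 1 \<and>
     (let s = 2 * b + 3 in (6 * (s\<^sup>2 - 1) + 2) * 10 ^ 17 \<le> (E * c - M) * (3 * s * (s\<^sup>2 - 1))) \<and>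
     (let s = 2 * b + 1 in E * (c + 2) * (3 * s ^ 3) \<le> (6 * s\<^sup>2 + 2) * 10 ^ 17)"

lemma tangent_check:
  fixes b c E M :: int and l :: real
  assumes "tangent_check E M b c" "E \<ge> 0" "c / 10 ^ 10 \<le> l" "l \<le> (c + 2) / 10 ^ 10"
  shows "ln ((real_of_int b + 2) / (real_of_int b + 1)) \<le> E / 10 ^ 7 * l - M / 10 ^ 17"
    and "E / 10 ^ 7 * l \<le> ln ((real_of_int b + 1) / b)"
proof -
  define B where "B = real_of_int b"
  have b: "B \<ge> 1" using assms(1) by (simp add: tangent_check_def B_def)
  have El: "E / 10 ^ 7 * (c / 10 ^ 10) \<le> E / 10 ^ 7 * l" "E / 10 ^ 7 * l \<le> E / 10 ^ 7 * ((c + 2) / 10 ^ 10)"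
    using assms by (intro mult_left_mono; simp)+
  define s where "s = 2 * (B + 1) + 1"
  have s: "s > 1" "3 * s * (s\<^sup>2 - 1) > 0"
    using b power_strict_mono[of 1 s 2] by (auto simp: s_def intro!: mult_pos_pos)
  have "(6 * (s\<^sup>2 - 1) + 2) * 10 ^ 17 \<le> (E * c - M) * (3 * s * (s\<^sup>2 - 1))"
  proof -
    have s_eq: "s = real_of_int (2 * b + 3)" by (simp add: s_def B_def)
    have "(6 * ((2 * b + 3)\<^sup>2 - 1) + 2) * 10 ^ 17 \<le> (E * c - M) * (3 * (2 * b + 3) * ((2 * b + 3)\<^sup>2 - 1))"
      using assms(1) unfolding tangent_check_def Let_def by blast
    from this[THEN of_int_le_iff[where 'a = real, THEN iffD2]] show ?thesis
      by (simp only: s_eq of_int_mult of_int_add of_int_diff of_int_power of_int_numeral of_int_1)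
  qed
  then have "(6 * (s\<^sup>2 - 1) + 2) / (3 * s * (s\<^sup>2 - 1)) \<le> (E * c - M) / 10 ^ 17"
    using s(2) by (simp add: divide_le_eq le_divide_eq pos_divide_le_eq pos_le_divide_eq mult.commute)
  moreover have "2 / s + 2 / (3 * s * (s\<^sup>2 - 1)) = (6 * (s\<^sup>2 - 1) + 2) / (3 * s * (s\<^sup>2 - 1))"
  proof -
    have "2 / s + 2 / (3 * s * t) = (6 * t + 2) / (3 * s * t)" if "t \<noteq> 0" for t
      using that s by (simp add: field_simps)
    then show ?thesis using s by (simp add: power2_eq_1_iff)
  qed
  moreover have "ln ((B + 1 + 1) / (B + 1)) \<le> 2 / s + 2 / (3 * s * (s\<^sup>2 - 1))"
    unfolding s_def using b by (intro ln_one_plus_inverse_bounds) auto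
  ultimately show "ln ((real_of_int b + 2) / (real_of_int b + 1)) \<le> E / 10 ^ 7 * l - M / 10 ^ 17"
    using El(1) by (simp add: B_def diff_divide_distrib add.assoc)
  define t where "t = 2 * B + 1"
  have t: "3 * t ^ 3 > 0" using b by (simp add: t_def)
  have "E * (c + 2) * (3 * t ^ 3) \<le> (6 * t\<^sup>2 + 2) * 10 ^ 17"
  proof -
    have t_eq: "t = real_of_int (2 * b + 1)" by (simp add: t_def B_def)
    have "E * (c + 2) * (3 * (2 * b + 1) ^ 3) \<le> (6 * (2 * b + 1)\<^sup>2 + 2) * 10 ^ 17"
      using assms(1) unfolding tangent_check_def Let_def by blast
    from this[THEN of_int_le_iff[where 'a = real, THEN iffD2]] show ?thesis
      by (simp only: t_eq of_int_mult of_int_add of_int_power of_int_numeral of_int_1)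
  qed
  then have "E * (c + 2) / 10 ^ 17 \<le> (6 * t\<^sup>2 + 2) / (3 * t ^ 3)"
    using t by (simp add: pos_divide_le_eq pos_le_divide_eq mult.commute)
  moreover have "(6 * t\<^sup>2 + 2) / (3 * t ^ 3) = 2 / t + 2 / (3 * t ^ 3)"
    using t by (auto simp: power2_eq_square power3_eq_cube add_divide_distrib)
  moreover have "2 / t + 2 / (3 * t ^ 3) \<le> ln ((B + 1) / B)"
    unfolding t_def using b by (intro ln_one_plus_inverse_bounds) auto
  moreover have "E / 10 ^ 7 * ((c + 2) / 10 ^ 10) = E * (c + 2) / 10 ^ 17" by simp
  ultimately show "E / 10 ^ 7 * l \<le> ln ((real_of_int b + 1) / b)"
    using El(2) unfolding B_def[symmetric] by linarith
qed

text \<open>Raising the Taylor coefficient 1/2 to 51/100 leaves room for the terms of higher order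
  when u is slightly negative.\<close>

lemma ln_one_plus_ge_quadratic:
  fixes u :: real
  assumes "- 1 / 100 \<le> u"
  shows "u - 51 / 100 * u\<^sup>2 \<le> ln (1 + u)"
proof (cases "u > 0")
  case True
  have "(1 + u - 1) / (1 + u + 1) = u / (2 + u)" by (simp add: add.commute)
  then have "2 * (u / (2 + u)) \<le> ln (1 + u)"
    using ln_approx_bounds[of "1 + u" 1] True by simp
  moreover have "u - 51 / 100 * u\<^sup>2 \<le> 2 * (u / (2 + u))"
  proof -
    have "(u - 51 / 100 * u\<^sup>2) * (2 + u) = 2 * u - u\<^sup>2 * (2 / 100 + 51 / 100 * u)"
      by (simp add: algebra_simps power2_eq_square)
    also have "\<dots> \<le> 2 * u" using True by simp
    finally show ?thesis using True by (simp add: pos_le_divide_eq)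
  qed
  ultimately show ?thesis by linarith
next
  case False
  define t where "t = - u"
  define w where "w = t + 51 / 100 * t\<^sup>2"
  have t: "0 \<le> t" "t \<le> 1 / 100" using False assms by (auto simp: t_def)
  have w: "w \<ge> 0" using t by (simp add: w_def)
  \<comment> \<open>Together with the quadratic Taylor bound for \<open>exp w\<close> this yields
    exp (- w) \<le> 1 - t. The surplus t^2 / 100 absorbs the higher powers of t because t \<le>
    1/100.\<close>
  have "1 \<le> (1 - t) * (1 + w + w\<^sup>2 / 2)"
  proof -
    have "(1 - t) * (1 + w + w\<^sup>2 / 2) - 1 = t\<^sup>2 * (1 / 100 - t / 2 - 37995 / 100000 * t\<^sup>2 - 13005 / 100000 * t ^ 3)"
      by (simp add: w_def field_simps power2_eq_square power3_eq_cube)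
    moreover have "t\<^sup>2 \<le> 1 / 100 * t" using t mult_right_mono[of t "1 / 100" t] by (simp add: power2_eq_square)
    moreover have "t ^ 3 \<le> 1 / 100 * t"
      using t mult_mono[of t 1 "t\<^sup>2" "1 / 100 * t"] calculation(2) by (simp add: power3_eq_cube power2_eq_square)
    moreover from calculation t
    have "0 \<le> t\<^sup>2 * (1 / 100 - t / 2 - 37995 / 100000 * t\<^sup>2 - 13005 / 100000 * t ^ 3)"
      by (intro mult_nonneg_nonneg zero_le_power2) linarith
    ultimately show ?thesis by linarith
  qed
  also have "\<dots> \<le> (1 - t) * exp w"
    using exp_lower_Taylor_quadratic[OF w] t by (intro mult_left_mono) auto
  finally have "exp (- w) \<le> 1 + u"
    by (simp add: t_def exp_minus field_simps)
  then have "- w \<le> ln (1 + u)" by (subst ln_ge_iff) (use t t_def in auto)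
  then show ?thesis by (simp add: w_def t_def)
qed

lemma ln_44_bounds:
  "37841896337 / 10 ^ 10 \<le> ln (44::real)" "ln (44::real) \<le> 37841896343 / 10 ^ 10"
proof -
  have "ln (44::real) = ln (2 ^ 2 * 11)" by simp
  also have "\<dots> = ln (2 ^ 2) + ln 11" by (rule ln_mult_pos) simp_all
  finally have "ln 44 = 2 * ln 2 + ln (11::real)" using ln_realpow[of "2::real" 2] by simp
  then show "37841896337 / 10 ^ 10 \<le> ln (44::real)" "ln (44::real) \<le> 37841896343 / 10 ^ 10"
    using ln_prime_seq_bounds[of 0] ln_prime_seq_bounds[of 4]
    by (simp_all add: prime_seq_eq_nth small_primes_def ln_primes_lower_def ln_prime_data_def
        del: enumerate_0 enumerate_Suc)
qed

text \<open>Adds the supporting lines with slopes \<epsilon> ln p for \<epsilon> = E / 10^7: the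
  exponents \<open>bs\<close> maximise ln (tau n) - \<epsilon> ln n, and exceeding \<open>bs\<close>
  at any prime costs at least M / 10^17.\<close>

lemma sum_ln_Suc_le_tangent:
  fixes bs :: "int list" and a :: "nat \<Rightarrow> nat" and E M :: int
  assumes len: "length bs = 44"
    and check: "list_all (\<lambda>(b, c). tangent_check E M b c) (zip bs ln_primes_lower)"
    and EM: "E \<ge> 0" "M \<ge> 0"
  shows "ln (\<Prod>i<44. real (a i) + 1) \<le> ln (prod_list (map (\<lambda>b. b + 1) bs))
    + E / 10 ^ 7 * ((\<Sum>i<44. a i * ln (prime_seq i)) - (\<Sum>i<44. bs ! i * ln (prime_seq i)))
    - (if \<exists>i<44. int (a i) > bs ! i then M / 10 ^ 17 else 0)"
proof -
  let ?l = "\<lambda>i. ln (real (prime_seq i))"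
  let ?m = "\<lambda>i. if int (a i) > bs ! i then M / 10 ^ 17 else 0 :: real"
  have chk: "tangent_check E M (bs ! i) (ln_primes_lower ! i)" if "i < 44" for i
    using check that len by (simp add: list_all_length length_ln_primes_lower)
  then have pos: "bs ! i \<ge> 1" if "i < 44" for i using that by (simp add: tangent_check_def)
  have "ln (real (a i) + 1) \<le> ln (bs ! i + 1) + E / 10 ^ 7 * ?l i * (a i - bs ! i) - ?m i"
    if i: "i < 44" for i
  proof -
    define b where "b = nat (bs ! i)"
    have b: "bs ! i = int b" "b \<ge> 1" using pos[OF i] by (auto simp: b_def)
    have "i < 45" using i by simp
    note T = tangent_check[OF chk[OF i] EM(1) ln_prime_seq_bounds[OF this]]
    have "ln (real (a i) + 1) \<le> ln (real b + 1) + E / 10 ^ 7 * ?l i * (real (a i) - real b)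
      - (if a i > b then M / 10 ^ 17 else 0)"
      using b(2) EM(2) T unfolding b(1) by (intro ln_Suc_le_tangent) simp_all
    then show ?thesis by (simp add: b(1))
  qed
  then have "(\<Sum>i<44. ln (real (a i) + 1)) \<le>
    (\<Sum>i<44. ln (bs ! i + 1) + E / 10 ^ 7 * ?l i * (a i - bs ! i) - ?m i)"
    by (intro sum_mono) simp
  also have "\<dots> = (\<Sum>i<44. ln (bs ! i + 1)) +
    E / 10 ^ 7 * ((\<Sum>i<44. a i * ?l i) - (\<Sum>i<44. bs ! i * ?l i)) - (\<Sum>i<44. ?m i)"
  proof -
    have "(\<Sum>i<44. ln (bs ! i + 1) + e * ?l i * (a i - bs ! i) - ?m i) = (\<Sum>i<44. ln (bs ! i + 1)) +
      e * ((\<Sum>i<44. a i * ?l i) - (\<Sum>i<44. bs ! i * ?l i)) - (\<Sum>i<44. ?m i)" for e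
      by (simp add: sum.distrib sum_subtractf sum_distrib_left algebra_simps)
    then show ?thesis .
  qed
  also have "(\<Sum>i<44. ln (bs ! i + 1)) = ln (prod_list (map (\<lambda>b. b + 1) bs))"
  proof -
    have "prod_list (map (\<lambda>b. b + 1) bs) = (\<Prod>i<44. bs ! i + 1)"
      by (simp add: prod.list_conv_set_nth len lessThan_atLeast0)
    moreover have "ln (\<Prod>i<44. real_of_int (bs ! i) + 1) = (\<Sum>i<44. ln (bs ! i + 1))"
      using pos by (subst ln_prod) force+
    ultimately show ?thesis by simp
  qed
  also have "(\<Sum>i<44. ln (real (a i) + 1)) = ln (\<Prod>i<44. real (a i) + 1)"
    by (subst ln_prod) auto
  finally have "ln (\<Prod>i<44. real (a i) + 1) \<le> ln (prod_list (map (\<lambda>b. b + 1) bs)) +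
    E / 10 ^ 7 * ((\<Sum>i<44. a i * ?l i) - (\<Sum>i<44. bs ! i * ?l i)) - (\<Sum>i<44. ?m i)" .
  moreover have "(if \<exists>i<44. int (a i) > bs ! i then M / 10 ^ 17 else 0) \<le> (\<Sum>i<44. ?m i)"
  proof (cases "\<exists>i<44. int (a i) > bs ! i")
    case True
    then obtain j where j: "j < 44" "int (a j) > bs ! j" by blast
    have "?m j \<le> (\<Sum>i<44. ?m i)"
      by (rule member_le_sum) (use j EM in auto)
    then show ?thesis using j True by simp
  qed (use EM in \<open>auto intro!: sum_nonneg\<close>)
  ultimately show ?thesis by linarith
qed

section \<open>Rounded 44th powers and the comparison with a champion\<close>

lemma power_44_eq: "(r::real) ^ 44 = (((r\<^sup>2)\<^sup>2)\<^sup>2)\<^sup>2 * (((r\<^sup>2)\<^sup>2)\<^sup>2)\<^sup>2 * ((r\<^sup>2)\<^sup>2)\<^sup>2 * (r\<^sup>2)\<^sup>2"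
  by (simp flip: power_mult power_add)

text \<open>The constants are rounded values of r, r^2, r^4, r^8, r^16, r^32, r^40 and r^44.
  Rounding after each multiplication keeps the numbers short; the next lemma does the same in the
  other direction.\<close>

lemma le_power_44:
  fixes r :: real
  assumes "0 \<le> ca" "0 \<le> cb" "0 \<le> cd" "0 \<le> ce" "0 \<le> cf" "0 \<le> cg" "0 \<le> ch" "ca \<le> r"
    "cb \<le> ca\<^sup>2" "cd \<le> cb\<^sup>2" "ce \<le> cd\<^sup>2" "cf \<le> ce\<^sup>2" "cg \<le> cf\<^sup>2" "ch \<le> cg * ce" "ci \<le> ch * cd"
  shows "ci \<le> r ^ 44"
proof -
  have sq: "c' \<le> s\<^sup>2" if "0 \<le> c" "c \<le> s" "c' \<le> c\<^sup>2" for c c' s :: real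
    using power_mono[OF that(2,1), of 2] that(3) by linarith
  note 2 = sq[OF assms(1,8,9)]
  note 4 = sq[OF assms(2) 2 assms(10)]
  note 8 = sq[OF assms(3) 4 assms(11)]
  note 16 = sq[OF assms(4) 8 assms(12)]
  note 32 = order_trans[OF assms(13) power_mono[OF 16 assms(5), of 2], unfolded power2_eq_square[of "(((r\<^sup>2)\<^sup>2)\<^sup>2)\<^sup>2"]]
  note 40 = order_trans[OF assms(14) mult_mono[OF 32 8 order_trans[OF assms(6) 32] assms(4)]]
  show ?thesis
    unfolding power_44_eq
    by (rule order_trans[OF assms(15) mult_mono[OF 40 4 order_trans[OF assms(7) 40] assms(3)]])
qed

lemma power_44_le:
  fixes r :: real
  assumes "0 \<le> r" "r \<le> ca" "ca\<^sup>2 \<le> cb" "cb\<^sup>2 \<le> cd" "cd\<^sup>2 \<le> ce" "ce\<^sup>2 \<le> cf" "cf\<^sup>2 \<le> cg"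
    "cg * ce \<le> ch" "ch * cd \<le> ci"
  shows "r ^ 44 \<le> ci"
proof -
  have sq: "s\<^sup>2 \<le> c'" if "0 \<le> s" "s \<le> c" "c\<^sup>2 \<le> c'" for c c' s :: real
    using power_mono[OF that(2,1), of 2] that(3) by linarith
  note 2 = sq[OF assms(1-3)]
  note 4 = sq[OF zero_le_power2 2 assms(4)]
  note 8 = sq[OF zero_le_power2 4 assms(5)]
  note 16 = sq[OF zero_le_power2 8 assms(6)]
  note 32 = sq[OF zero_le_power2 16 assms(7), unfolded power2_eq_square[of "(((r\<^sup>2)\<^sup>2)\<^sup>2)\<^sup>2"]]
  have 40: "(((r\<^sup>2)\<^sup>2)\<^sup>2)\<^sup>2 * (((r\<^sup>2)\<^sup>2)\<^sup>2)\<^sup>2 * ((r\<^sup>2)\<^sup>2)\<^sup>2 \<le> ch"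
    by (rule order_trans[OF mult_mono[OF 32 8] assms(8)])
      (auto intro: order_trans[OF _ 32] mult_nonneg_nonneg)
  show ?thesis
    unfolding power_44_eq
    by (rule order_trans[OF mult_mono[OF 40 4] assms(9)])
      (auto intro: order_trans[OF _ 40] mult_nonneg_nonneg)
qed

text \<open>N / D bounds the ratio of \<open>t\<close> to the 44th power that lambda \<ge> 1 demands
  at size L, and ln x \<le> x - 1 turns it into an additive slack. The denominator 1665043439092 is
  10^10 times an upper bound for 44 ln 44.\<close>

lemma ln_le_44_ln:
  fixes t S N D :: int and L r c :: real
  assumes "t > 0" "S > 0" "N > 0" "D > 0" "S / 10 ^ 10 \<le> L"
    and r: "r \<le> 1 + S / 1665043439092" "c \<le> r ^ 44" "0 \<le> r"
    and check: "t * D \<le> c * N"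
  shows "ln t \<le> 44 * ln (1 + L / (44 * ln 44)) + (N / D - 1)"
proof -
  define V where "V = 44 * ln (44::real)"
  define R where "R = 1 + L / V"
  have V: "V > 0" "V \<le> 1665043439092 / 10 ^ 10" using ln_44_bounds unfolding V_def by simp_all
  have "0 < S / (10 ^ 10 :: real)" using assms(2) by simp
  then have "L > 0" using assms(5) by linarith
  then have "R > 0" using V by (simp add: R_def add_pos_pos)
  have "r \<le> 1 + (S / 10 ^ 10) / (1665043439092 / 10 ^ 10)" using r by simp
  also have "\<dots> \<le> R"
    unfolding R_def using V assms(2,5) by (intro add_left_mono frac_le) auto
  finally have "r ^ 44 \<le> R ^ 44" using r(3) by (rule power_mono)
  then have "c * (N / D) \<le> R ^ 44 * (N / D)"
    using assms(3,4) r(2) by (intro mult_right_mono) auto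
  moreover have "real_of_int t \<le> c * (N / D)"
    using check assms(4) by (simp add: field_simps)
  ultimately have "real_of_int t \<le> R ^ 44 * (N / D)" by linarith
  then have "ln t \<le> ln (R ^ 44 * (N / D))"
    using assms(1) by (intro ln_mono) simp_all
  also have "\<dots> = 44 * ln R + ln (N / D)"
    using \<open>R > 0\<close> assms(3,4) by (subst ln_mult_pos) (simp_all add: ln_realpow)
  also have "ln (N / D) \<le> N / D - 1" using assms(3,4) by (intro ln_le_minus_one) simp
  finally show ?thesis by (simp add: R_def V_def)
qed

definition log_size :: "int list \<Rightarrow> real" where
  "log_size bs = (\<Sum>i<44. real_of_int (bs ! i) * ln (prime_seq i))"

lemma log_size_bounds:
  assumes "length bs = 44" "list_all (\<lambda>b. b \<ge> 0) bs"
  shows "sum_list (map2 (*) bs ln_primes_lower) / 10 ^ 10 \<le> log_size bs"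
    and "log_size bs \<le> (sum_list (map2 (*) bs ln_primes_lower) + 2 * sum_list bs) / 10 ^ 10"
proof -
  have "length bs \<le> 45" using assms(1) by simp
  note * = weighted_sum_ln_prime_bounds[OF this assms(2), unfolded assms(1), folded log_size_def]
  show "sum_list (map2 (*) bs ln_primes_lower) / 10 ^ 10 \<le> log_size bs"
    by (rule *(1))
  show "log_size bs \<le> (sum_list (map2 (*) bs ln_primes_lower) + 2 * sum_list bs) / 10 ^ 10"
    by (rule *(2))
qed

text \<open>With V = 44 ln 44, the number \<open>u\<close> is the relative change of V + ln n from
  the champion to \<open>n\<close>, so 1 + ln n / V is the champion's value times 1 + u. Hence
  lambda \<ge> 1 bounds ln (tau n) from below with the extra term 44 ln (1 + u), while the tangent
  bound allows only the linear term \<epsilon> T u, the slack N / D - 1 and the penalty. Expanding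
  ln (1 + u) to second order gives 2244/100 = 44 * 51/100.\<close>

lemma window_bound:
  fixes n :: nat and q a :: "nat \<Rightarrow> nat" and bs :: "int list" and E M S N D :: int and r c :: real
  assumes q: "\<And>i. i < 44 \<Longrightarrow> prime_seq i \<le> q i"
    and n: "n = (\<Prod>i<44. q i ^ a i)"
    and large: "(1 + ln n / (44 * ln 44)) ^ 44 \<le> (\<Prod>i<44. real (a i) + 1)"
    and len: "length bs = 44"
    and check: "list_all (\<lambda>(b, c). tangent_check E M b c) (zip bs ln_primes_lower)"
    and pos: "E \<ge> 0" "M \<ge> 0" "S > 0" "N > 0" "D > 0"
    and S: "S / 10 ^ 10 \<le> log_size bs"
    and r: "r \<le> 1 + S / 1665043439092" "c \<le> r ^ 44" "0 \<le> r"
    and check': "prod_list (map (\<lambda>b. b + 1) bs) * D \<le> c * N"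
  defines "T \<equiv> 44 * ln 44 + log_size bs"
  defines "u \<equiv> (ln n - log_size bs) / T"
  assumes u: "- 1 / 100 \<le> u"
  shows "(44 - E / 10 ^ 7 * T) * u - 2244 / 100 * u\<^sup>2
    \<le> N / D - 1 - (if \<exists>i<44. int (a i) > bs ! i then M / 10 ^ 17 else 0)"
proof -
  define V where "V = 44 * ln (44::real)"
  define L where "L = log_size bs"
  define t where "t = prod_list (map (\<lambda>b. b + 1) bs)"
  define pen where "pen = (if \<exists>i<44. int (a i) > bs ! i then M / 10 ^ 17 else 0 :: real)"
  have "V > 0" by (simp add: V_def)
  have "0 < S / (10 ^ 10 :: real)" using pos by simp
  then have "L > 0" using S unfolding L_def by linarith
  have T: "T = V + L" by (simp add: T_def V_def L_def)
  then have "T > 0" using \<open>V > 0\<close> \<open>L > 0\<close> by linarith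
  have "t > 0"
  proof -
    have "list_all (\<lambda>b. b \<ge> 1) bs"
      using check len by (auto simp: list_all_length length_ln_primes_lower tangent_check_def)
    then show ?thesis unfolding t_def by (induction bs) auto
  qed
  have pos_q: "q i > 0" if "i < 44" for i
    using q[OF that] prime_prime_seq[of i] prime_gt_0_nat[of "prime_seq i"] by linarith
  have sum_le: "(\<Sum>i<44. a i * ln (prime_seq i)) \<le> ln n"
  proof -
    have "ln n = (\<Sum>i<44. a i * ln (q i))"
      unfolding n using pos_q by (rule ln_eq_sum_factorization)
    also have "\<dots> \<ge> (\<Sum>i<44. a i * ln (prime_seq i))"
    proof (intro sum_mono mult_left_mono ln_mono)
      fix i :: nat assume "i \<in> {..<44}"
      then show "real (prime_seq i) \<le> real (q i)" using q by simp
      show "0 < real (prime_seq i)" using prime_prime_seq[of i] by (simp add: prime_gt_0_nat)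
    qed auto
    finally show ?thesis .
  qed
  have n_pos: "n > 0" unfolding n using pos_q by (auto intro!: prod_pos)
  then have base_pos: "1 + ln n / V > 0" using \<open>V > 0\<close> by (simp add: add_pos_nonneg)
  have "44 * ln (1 + L / V) + 44 * ln (1 + u) = 44 * ln ((1 + L / V) * (1 + u))"
    using \<open>L > 0\<close> \<open>V > 0\<close> u by (subst ln_mult_pos) (auto intro!: add_pos_pos)
  also have "(1 + L / V) * (1 + u) = 1 + ln n / V"
  proof -
    have "1 + u = (V + ln n) / T" using T \<open>T > 0\<close> by (simp add: u_def L_def[symmetric] field_simps)
    moreover have "1 + L / V = T / V" using T \<open>V > 0\<close> by (simp add: field_simps)
    ultimately show ?thesis using \<open>T > 0\<close> \<open>V > 0\<close> by (simp add: field_simps)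
  qed
  also have "44 * ln (1 + ln n / V) = ln ((1 + ln n / V) ^ 44)"
    using ln_realpow[of "1 + ln n / V" 44] base_pos by simp
  also have "\<dots> \<le> ln (\<Prod>i<44. real (a i) + 1)"
    using large base_pos unfolding V_def[symmetric] by (intro ln_mono) simp_all
  also have "\<dots> \<le> ln t + E / 10 ^ 7 * ((\<Sum>i<44. a i * ln (prime_seq i)) - L) - pen"
    unfolding t_def L_def pen_def log_size_def using sum_ln_Suc_le_tangent[OF len check pos(1,2)] .
  also have "\<dots> \<le> ln t + E / 10 ^ 7 * (ln n - L) - pen"
    using sum_le pos(1) by (intro diff_right_mono add_left_mono mult_left_mono) auto
  also have "ln n - L = T * u" using \<open>T > 0\<close> by (simp add: u_def L_def[symmetric])
  also have "ln t \<le> 44 * ln (1 + L / V) + (N / D - 1)"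
    unfolding V_def L_def by (rule ln_le_44_ln[OF \<open>t > 0\<close> pos(3-5) S r check'[folded t_def]])
  finally have "44 * ln (1 + u) \<le> E / 10 ^ 7 * (T * u) + (N / D - 1) - pen" by simp
  moreover have "44 * (u - 51 / 100 * u\<^sup>2) \<le> 44 * ln (1 + u)"
    using ln_one_plus_ge_quadratic[OF u] by simp
  ultimately have "44 * (u - 51 / 100 * u\<^sup>2) \<le> E / 10 ^ 7 * (T * u) + (N / D - 1) - pen" by linarith
  then show ?thesis by (simp add: pen_def algebra_simps)
qed

section \<open>The three champions and their numerical data\<close>

text \<open>The exponents that maximise \<open>ln (tau n) - \<epsilon> * ln n\<close> over products \<open>n\<close> of powers of the first
  \<open>44\<close> primes, for \<open>\<epsilon> = 0.0040667\<close>, \<open>0.0040520\<close> and \<open>0.0040320\<close>.\<close>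

definition champion :: "int list" where
  "champion =
    [354, 223, 152, 125, 102, 95, 86, 83, 77, 72, 71, 67, 65, 64, 63, 61, 59, 59, 57, 57, 56, 55,
     55, 54, 53, 52, 52, 52, 51, 51, 50, 49, 49, 49, 48, 48, 48, 47, 47, 47, 46, 46, 46, 46]"

definition champion1 :: "int list" where
  "champion1 =
    [355, 224, 152, 126, 102, 95, 86, 83, 78, 72, 71, 67, 65, 65, 63, 61, 60, 59, 58, 57, 57, 55,
     55, 54, 53, 52, 52, 52, 52, 51, 50, 50, 49, 49, 48, 48, 48, 47, 47, 47, 47, 46, 46, 46]"

definition champion2 :: "int list" where
  "champion2 =
    [357, 225, 153, 126, 102, 96, 87, 83, 78, 73, 71, 68, 66, 65, 63, 61, 60, 59, 58, 57, 57, 56,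
     55, 54, 53, 53, 53, 52, 52, 51, 50, 50, 49, 49, 49, 48, 48, 48, 47, 47, 47, 47, 46, 46]"

lemma champion_eq: "champion = map int exponents"
  by (simp add: champion_def exponents_def)

lemma champion_checks:
  "list_all (\<lambda>(b, c). tangent_check 40667 460000000000 b c) (zip champion ln_primes_lower)"
  "list_all (\<lambda>(b, c). tangent_check 40520 0 b c) (zip champion1 ln_primes_lower)"
  "list_all (\<lambda>(b, c). tangent_check 40320 0 b c) (zip champion2 ln_primes_lower)"
  by code_simp+

lemma champion_sums:
  "sum_list (map2 (*) champion ln_primes_lower) = 106408428154299" "sum_list champion = 3189"
  "sum_list (map2 (*) champion1 ln_primes_lower) = 106788037998949" "sum_list champion1 = 3200"
  "sum_list (map2 (*) champion2 ln_primes_lower) = 107279035838627" "sum_list champion2 = 3215"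
  by code_simp+

lemma log_size_champions:
  "106408428154299 / 10 ^ 10 \<le> log_size champion" "log_size champion \<le> 106408428160677 / 10 ^ 10"
  "106788037998949 / 10 ^ 10 \<le> log_size champion1" "log_size champion1 \<le> 106788038005349 / 10 ^ 10"
  "107279035838627 / 10 ^ 10 \<le> log_size champion2" "log_size champion2 \<le> 107279035845057 / 10 ^ 10"
proof -
  have "length champion = 44" "list_all (\<lambda>b. b \<ge> 0) champion"
    "length champion1 = 44" "list_all (\<lambda>b. b \<ge> 0) champion1"
    "length champion2 = 44" "list_all (\<lambda>b. b \<ge> 0) champion2"
    by (simp_all add: champion_def champion1_def champion2_def)
  then show "106408428154299 / 10 ^ 10 \<le> log_size champion" "log_size champion \<le> 106408428160677 / 10 ^ 10"
    "106788037998949 / 10 ^ 10 \<le> log_size champion1" "log_size champion1 \<le> 106788038005349 / 10 ^ 10"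
    "107279035838627 / 10 ^ 10 \<le> log_size champion2" "log_size champion2 \<le> 107279035845057 / 10 ^ 10"
    using log_size_bounds[of champion] log_size_bounds[of champion1] log_size_bounds[of champion2]
    unfolding champion_sums by simp_all
qed

lemma prod_champions:
  "prod_list (map (\<lambda>b. b + 1) champion) = 55070229630217149840617492052999215261045902171749515314891362769305600000000000"
  "prod_list (map (\<lambda>b. b + 1) champion1) = 64245260317831570383500535375147684697558175566039958875887753528921292800000000"
  "prod_list (map (\<lambda>b. b + 1) champion2) = 78355216329595482912131930631454683262183803430881815367177667480230297600000000"
  by (simp_all add: champion_def champion1_def champion2_def)

text \<open>The bases approximate 1 + L / (44 ln 44): from below for the sizes L of the three
  champions, from above for L = ln n_star, and from below for L = ln n_star + 0.2.\<close>

lemma champion_powers: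
  "55070053697523460000000000000000000000000000000000000000000000000000000000000000 \<le> ((1014176539783 / 15625000000) :: real) ^ 44"
  "64256700369311100000000000000000000000000000000000000000000000000000000000000000 \<le> ((65135286498701 / 1000000000000) :: real) ^ 44"
  "78385339483275620000000000000000000000000000000000000000000000000000000000000000 \<le> ((32715086201333 / 500000000000) :: real) ^ 44"
  "0 \<le> r \<Longrightarrow> r \<le> 64907298560077 / 1000000000000 \<Longrightarrow> r ^ 44 \<le> (55070054218858040000000000000000000000000000000000000000000000000000000000000000 :: real)"
  "55114912933897480000000000000000000000000000000000000000000000000000000000000000 \<le> ((8113562464497 / 125000000000) :: real) ^ 44"
  subgoal by (rule le_power_44
      [where ca = "1014176539783 / 15625000000"
        and cb = "32913729723079 / 7812500000"
        and cd = "1774901009258731 / 100000000"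
        and ce = "3150273592667661 / 10"
        and cf = "99242237086592120000000000000"
        and cg = "9849021621951360000000000000000000000000000000000000000000"
        and ch = "3102711272924618000000000000000000000000000000000000000000000000000000000"])
      (simp_all add: power_divide)
  subgoal by (rule le_power_44
      [where ca = "65135286498701 / 1000000000000"
        and cb = "212130277363393 / 50000000000"
        and cd = "1799970182970801 / 100000000"
        and ce = "1619946329791969 / 5"
        and cf = "104969044456258800000000000000"
        and cg = "11018500294060030000000000000000000000000000000000000000000"
        and ch = "3569875822234855000000000000000000000000000000000000000000000000000000000"])
      (simp_all add: power_divide)
  subgoal by (rule le_power_44
      [where ca = "32715086201333 / 500000000000"
        and cb = "856221492128519 / 200000000000"
        and cd = "229098513619621 / 12500000"
        and ce = "1679556126167029 / 5"
        and cf = "112836351237807800000000000000"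
        and cg = "12732042160661920000000000000000000000000000000000000000000"
        and ch = "4276835881911324000000000000000000000000000000000000000000000000000000000"])
      (simp_all add: power_divide)
  subgoal by (rule power_44_le
      [where ca = "64907298560077 / 1000000000000"
        and cb = "2106478703183487 / 500000000000"
        and cd = "354980202157247 / 20000000"
        and ce = "3150273598089999 / 10"
        and cf = "99242237428229090000000000000"
        and cg = "9849021689760995000000000000000000000000000000000000000000"
        and ch = "3102711299626982000000000000000000000000000000000000000000000000000000000"])
      (simp_all add: power_divide)
  subgoal by (rule le_power_44
      [where ca = "8113562464497 / 125000000000"
        and cb = "526639166922357 / 125000000000"
        and cd = "887516198837357 / 50000000"
        and ce = "1575370006397422 / 5"
        and cf = "99271626282264530000000000000"
        and cg = "9854855784725593000000000000000000000000000000000000000000"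
        and ch = "3105008844125765000000000000000000000000000000000000000000000000000000000"])
      (simp_all add: power_divide)
  done

section \<open>The number \<open>n_star\<close> satisfies the condition\<close>

lemma n_star_eq: "n_star = (\<Prod>i<44. prime_seq i ^ (exponents ! i))"
  unfolding n_star_def nth_prime_def
  by (rule prod.reindex_bij_witness[of _ Suc "\<lambda>i. i - 1"]) auto

lemma length_exponents: "length exponents = 44"
  by (simp add: exponents_def)

lemma exponents_bounds: "i < 44 \<Longrightarrow> 46 \<le> exponents ! i" "i < 44 \<Longrightarrow> exponents ! i \<le> 354"
proof -
  have "list_all (\<lambda>e. 46 \<le> e \<and> e \<le> 354) exponents" by (simp add: exponents_def)
  then show "i < 44 \<Longrightarrow> 46 \<le> exponents ! i" "i < 44 \<Longrightarrow> exponents ! i \<le> 354"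
    unfolding list_all_length length_exponents by auto
qed

lemma champion_nth: "i < 44 \<Longrightarrow> champion ! i = int (exponents ! i)"
  by (simp add: champion_eq length_exponents)

lemma prod_exponents: "(\<Prod>i<44. real (exponents ! i) + 1) = 55070229630217149840617492052999215261045902171749515314891362769305600000000000"
proof -
  have "length champion = 44" by (simp add: champion_def)
  then have "prod_list (map (\<lambda>b. b + 1) champion) = (\<Prod>i<44. champion ! i + 1)"
    by (simp add: prod.list_conv_set_nth lessThan_atLeast0)
  also have "\<dots> = (\<Prod>i<44. int (exponents ! i) + 1)"
    by (intro prod.cong) (auto simp: champion_nth)
  finally have "real_of_int (\<Prod>i<44. int (exponents ! i) + 1) = real_of_int 55070229630217149840617492052999215261045902171749515314891362769305600000000000"
    unfolding prod_champions by (simp only:)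
  then show ?thesis by simp
qed

lemma n_star_facts:
  "omega n_star = 44" "tau n_star = (\<Prod>i<44. real (exponents ! i) + 1)" "n_star > 1"
  "ln n_star = log_size champion"
proof -
  have inj: "inj_on prime_seq {..<44}"
    using inj_enumerate[OF infinite_primes] by (rule inj_on_subset) simp
  have exp: "exponents ! i \<ge> 1" if "i < 44" for i using exponents_bounds(1)[OF that] by simp
  have facts: "n_star > 0" "omega n_star = 44" "tau n_star = (\<Prod>i<44. exponents ! i + 1)"
    unfolding n_star_eq
    by (rule omega_tau_prod_prime_powers[OF inj prime_prime_seq exp]; simp)+
  show "omega n_star = 44" by (rule facts)
  show "tau n_star = (\<Prod>i<44. real (exponents ! i) + 1)"
    using facts(3) by (simp add: add.commute)
  show "n_star > 1"
  proof (rule ccontr)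
    assume "\<not> n_star > 1"
    then have one: "n_star = 1" using facts(1) by simp
    show False using facts(2) unfolding one by (simp add: omega_def)
  qed
  have pos: "prime_seq i > 0" for i using prime_prime_seq[of i] by (rule prime_gt_0_nat)
  show "ln n_star = log_size champion"
    unfolding n_star_eq log_size_def
    by (subst ln_eq_sum_factorization) (auto simp: pos champion_nth intro!: sum.cong)
qed

text \<open>\<open>tau n_star\<close> exceeds the required 44th power by a factor of only about 1 +
  3.2 * 10^-6, which is why the logarithms are needed to ten decimals.\<close>

lemma lambda_n_star: "lambda n_star \<ge> 1"
proof -
  have "1 + ln n_star / (44 * ln 44) \<le> 1 + (106408428160677 / 10 ^ 10) / (44 * (37841896337 / 10 ^ 10))"
    unfolding n_star_facts(4) using log_size_champions(1,2) ln_44_bounds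
    by (intro add_left_mono frac_le) auto
  also have "\<dots> \<le> 64907298560077 / 1000000000000" by simp
  finally have "(1 + ln n_star / (44 * ln 44)) ^ 44 \<le> 55070054218858040000000000000000000000000000000000000000000000000000000000000000"
    using n_star_facts(3) by (intro champion_powers(4)) auto
  also have "\<dots> \<le> tau n_star" unfolding n_star_facts(2) prod_exponents by simp
  finally show ?thesis
    using one_le_lambda_iff[OF n_star_facts(3)] by (simp add: n_star_facts(1))
qed

section \<open>Excluding larger numbers with 44 prime factors\<close>

text \<open>The constant \<open>c\<close> is a lower bound for the geometric mean of the logarithms
  of the first 44 primes. It exceeds ln 44 by barely 0.004, so the inequality of the means confines
  \<open>ln n\<close>, but not sharply enough to reach ln n_star.\<close>

lemma ln_le_if_omega_44:
  assumes "omega n = 44" "lambda n \<ge> 1"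
  shows "ln n \<le> 10780"
proof -
  define l where "l = ln (44::real)"
  define c :: real where "c = 3788166 / 1000000"
  let ?s = "\<Sum>i<44. ln (real (prime_seq i))"
  have "37881660000 ^ 44 \<le> prod_list (take 44 ln_primes_lower)" by code_simp
  then have "(real_of_int 37881660000 / 10 ^ 10) ^ 44 \<le> (\<Prod>i<44. ln (prime_seq i))"
    by (rule prod_ln_prime_ge[rotated]) simp
  moreover have "real_of_int 37881660000 / 10 ^ 10 = c" by (simp add: c_def)
  ultimately have "c ^ 44 \<le> (\<Prod>i<44. ln (prime_seq i))" by (simp only:)
  moreover have "0 < ln (real (prime_seq i)) \<and> ln (real (prime_seq i)) \<le> ln (prime_seq i)" for i
    using prime_prime_seq[of i] prime_ge_2_nat[of "prime_seq i"] by simp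
  ultimately have *: "c * (ln n + 44 * l) \<le> l * (ln n + ?s)"
    using one_le_lambda_imp[of n "\<lambda>i. ln (prime_seq i)" c] assms by (simp add: l_def c_def)
  have s: "?s \<le> 177987 / 1000"
  proof -
    have "sum_list (map2 (*) (replicate 44 1) ln_primes_lower) + 2 * sum_list (replicate 44 1) \<le> 1779870000000"
      by code_simp
    moreover have "list_all (\<lambda>b. b \<ge> 0) (replicate 44 (1::int))" by (simp add: list_all_iff)
    ultimately show ?thesis
      using weighted_sum_ln_prime_bounds(2)[of "replicate 44 1"] by simp
  qed
  have l: "37841896337 / 10 ^ 10 \<le> l" "l \<le> 37841896343 / 10 ^ 10" using ln_44_bounds by (simp_all add: l_def)
  have "(c - l) * ln n \<le> l * (?s - 44 * c)" using * by (simp add: algebra_simps)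
  also have "\<dots> \<le> (3784190 / 1000000) * (177987 / 1000 - 44 * c)"
  proof -
    have "l * (?s - 44 * c) \<le> l * (177987 / 1000 - 44 * c)" using s l by (intro mult_left_mono) auto
    also have "\<dots> \<le> (3784190 / 1000000) * (177987 / 1000 - 44 * c)"
      using l by (intro mult_right_mono) (auto simp: c_def)
    finally show ?thesis .
  qed
  also have "\<dots> \<le> 428 / 10" by (simp add: c_def)
  finally have "(c - l) * ln n \<le> 428 / 10" .
  moreover have "n > 0" using assms by (cases n) (auto simp: omega_def)
  then have "3976 / 1000000 * ln n \<le> (c - l) * ln n"
    using l by (intro mult_right_mono) (auto simp: c_def)
  ultimately show ?thesis by simp
qed

lemma le_n_star_if_omega_44:
  assumes "omega n = 44" "lambda n \<ge> 1"
  shows "n \<le> n_star"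
proof (rule ccontr)
  assume "\<not> n \<le> n_star"
  then have "n > n_star" by simp
  define L where "L = ln (real n)"
  define L0 where "L0 = log_size champion"
  define V where "V = 44 * ln (44::real)"
  have n: "n > 1" using \<open>n > n_star\<close> n_star_facts(3) by simp
  have "L > L0"
    unfolding L_def L0_def n_star_facts(4)[symmetric] using \<open>n > n_star\<close> n_star_facts(3) by simp
  have "L \<le> 10780" unfolding L_def using assms by (rule ln_le_if_omega_44)
  have V: "1665043438828 / 10 ^ 10 \<le> V" "V \<le> 1665043439092 / 10 ^ 10"
    using ln_44_bounds unfolding V_def by simp_all
  have L0: "106408428154299 / 10 ^ 10 \<le> L0" "L0 \<le> 106408428160677 / 10 ^ 10"
    unfolding L0_def by (rule log_size_champions)+
  obtain q a :: "nat \<Rightarrow> nat" where q: "\<And>i. i < 44 \<Longrightarrow> prime_seq i \<le> q i"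
    and nq: "n = (\<Prod>i<44. q i ^ a i)" and tau: "tau n = (\<Prod>i<44. a i + 1)"
    using factorization_sorted[of n] n unfolding assms(1) by auto
  have large: "(1 + ln n / (44 * ln 44)) ^ 44 \<le> (\<Prod>i<44. real (a i) + 1)"
    using one_le_lambda_iff[OF n] assms tau by (simp add: add.commute)
  have lower: "r ^ 44 \<le> (\<Prod>i<44. real (a i) + 1)"
    if "0 \<le> r" "r \<le> 1 + S / 1665043439092" "0 \<le> S" "S / 10 ^ 10 \<le> L" for r S :: real
  proof -
    have "r \<le> 1 + (S / 10 ^ 10) / (1665043439092 / 10 ^ 10)" using that by simp
    also have "\<dots> \<le> 1 + L / V"
      using V that by (intro add_left_mono frac_le) auto
    finally have "r ^ 44 \<le> (1 + L / V) ^ 44" using that(1) by (rule power_mono)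
    then show ?thesis using large by (simp add: L_def V_def)
  qed
  \<comment> \<open>One champion serves each range: the sizes of \<open>champion1\<close> and
    \<open>champion2\<close> are about L0 + 38 and L0 + 87, so \<open>u\<close> stays small.\<close>
  consider "L \<le> L0 + 22" | "L0 + 22 \<le> L" "L \<le> L0 + 80" | "L0 + 80 \<le> L" by linarith
  then show False
  proof cases
    case 2
    define T where "T = V + log_size champion1"
    define u where "u = (L - log_size champion1) / T"
    have T: "108453 / 10 \<le> T" "T \<le> 1084531 / 100"
      "548113 / 10000000 \<le> 44 - 40520 / 10 ^ 7 * T" "44 - 40520 / 10 ^ 7 * T \<le> 548115 / 10000000"
      using V log_size_champions(3,4) unfolding T_def by simp_all
    have u: "- 17 / 10000 \<le> u" "u \<le> 41 / 10000"
      using T 2 L0 log_size_champions(3,4) unfolding u_def by (simp_all add: field_simps)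
    have "(44 - real_of_int 40520 / 10 ^ 7 * T) * u - 2244 / 100 * u\<^sup>2 \<le> real_of_int 9998220 / real_of_int 10000000 - 1
      - (if \<exists>i<44. int (a i) > champion1 ! i then real_of_int 0 / 10 ^ 17 else 0)"
      unfolding T_def u_def V_def L_def
    proof (rule window_bound[OF q nq large])
      show "length champion1 = 44" by (simp add: champion1_def)
      show "real_of_int 106788037998949 / 10 ^ 10 \<le> log_size champion1" using log_size_champions(3) by simp
      show "65135286498701 / 1000000000000 \<le> 1 + real_of_int 106788037998949 / 1665043439092" by simp
      show "real_of_int (prod_list (map (\<lambda>b. b + 1) champion1) * 10000000) \<le> 64256700369311100000000000000000000000000000000000000000000000000000000000000000 * real_of_int 9998220"
        unfolding prod_champions by simp
      show "- 1 / 100 \<le> (ln n - log_size champion1) / (44 * ln 44 + log_size champion1)"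
        using u unfolding T_def u_def V_def L_def by simp
    qed (rule champion_checks champion_powers | simp)+
    then have "(44 - 40520 / 10 ^ 7 * T) * u - 2244 / 100 * u\<^sup>2 \<le> 9998220 / 10000000 - 1"
      by (simp split: if_split_asm)
    \<comment> \<open>The chord of u^2 over the range of u; it contributes the slope 22.44 * 0.0024
      = 0.053856. The left side then stays above about -1.58 * 10^-4, whereas
      \<open>champion1\<close> misses the condition by 1.78 * 10^-4.\<close>
    moreover have "u\<^sup>2 \<le> 24 / 10000 * u + 697 / 100000000"
    proof -
      have "0 \<le> (u + 17 / 10000) * (41 / 10000 - u)" using u by (intro mult_nonneg_nonneg) auto
      then show ?thesis by (simp add: algebra_simps power2_eq_square)
    qed
    moreover have "0 \<le> (44 - 40520 / 10 ^ 7 * T - 53856 / 1000000) * (u + 17 / 10000)"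
      using T u by (intro mult_nonneg_nonneg) auto
    ultimately show False using T by (simp add: algebra_simps)
  next
    case 3
    define T where "T = V + log_size champion2"
    define u where "u = (L - log_size champion2) / T"
    have T: "108944 / 10 \<le> T" "T \<le> 1089441 / 100"
      "737472 / 10000000 \<le> 44 - 40320 / 10 ^ 7 * T" "44 - 40320 / 10 ^ 7 * T \<le> 737473 / 10000000"
      using V log_size_champions(5,6) unfolding T_def by simp_all
    have u: "- 25 / 10000 \<le> u" "u \<le> 58 / 10000"
      using T 3 L0 \<open>L \<le> 10780\<close> log_size_champions(5,6) unfolding u_def by (simp_all add: field_simps)
    have "(44 - real_of_int 40320 / 10 ^ 7 * T) * u - 2244 / 100 * u\<^sup>2 \<le> real_of_int 9996160 / real_of_int 10000000 - 1
      - (if \<exists>i<44. int (a i) > champion2 ! i then real_of_int 0 / 10 ^ 17 else 0)"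
      unfolding T_def u_def V_def L_def
    proof (rule window_bound[OF q nq large])
      show "length champion2 = 44" by (simp add: champion2_def)
      show "real_of_int 107279035838627 / 10 ^ 10 \<le> log_size champion2" using log_size_champions(5) by simp
      show "32715086201333 / 500000000000 \<le> 1 + real_of_int 107279035838627 / 1665043439092" by simp
      show "real_of_int (prod_list (map (\<lambda>b. b + 1) champion2) * 10000000) \<le> 78385339483275620000000000000000000000000000000000000000000000000000000000000000 * real_of_int 9996160"
        unfolding prod_champions by simp
      show "- 1 / 100 \<le> (ln n - log_size champion2) / (44 * ln 44 + log_size champion2)"
        using u unfolding T_def u_def V_def L_def by simp
    qed (rule champion_checks champion_powers | simp)+
    then have "(44 - 40320 / 10 ^ 7 * T) * u - 2244 / 100 * u\<^sup>2 \<le> 9996160 / 10000000 - 1"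
      by (simp split: if_split_asm)
    moreover have "u\<^sup>2 \<le> 33 / 10000 * u + 145 / 10000000"
    proof -
      have "0 \<le> (u + 25 / 10000) * (58 / 10000 - u)" using u by (intro mult_nonneg_nonneg) auto
      then show ?thesis by (simp add: algebra_simps power2_eq_square)
    qed
    \<comment> \<open>After the chord bound the slope is slightly negative here, 0.074052 being
      22.44 * 0.0033, so the linear term is smallest at the right end u = 58/10000.\<close>
    moreover have "- 18 / 10000000 \<le> (A - 74052 / 1000000) * u" if "737472 / 10000000 \<le> A" "A \<le> 737473 / 10000000" for A
    proof -
      have "0 \<le> (74052 / 1000000 - A) * (58 / 10000 - u)"
        using that u by (intro mult_nonneg_nonneg) auto
      also have "\<dots> = (A - 74052 / 1000000) * u - (A - 74052 / 1000000) * (58 / 10000)"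
        by (simp add: field_simps)
      finally have "(A - 74052 / 1000000) * (58 / 10000) \<le> (A - 74052 / 1000000) * u"
        by (simp only: diff_ge_0_iff_ge)
      moreover have "- 18 / 10000000 \<le> (A - 74052 / 1000000) * (58 / 10000)" using that by simp
      ultimately show ?thesis by (rule order_trans[rotated])
    qed
    from this[OF T(3,4)]
    have "- 18 / 10000000 \<le> (44 - 40320 / 10 ^ 7 * T) * u - 74052 / 1000000 * u"
      unfolding left_diff_distrib .
    ultimately show False by linarith
  next
    case 1
    define T where "T = V + log_size champion"
    define u where "u = (L - log_size champion) / T"
    have T: "108073 / 10 \<le> T" "T \<le> 1080735 / 100"
      "497613 / 10000000 \<le> 44 - 40667 / 10 ^ 7 * T"
      using V log_size_champions(1,2) unfolding T_def by simp_all
    have u: "0 \<le> u" "u \<le> 205 / 100000"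
      using T 1 \<open>L > L0\<close> unfolding u_def L0_def by (simp_all add: field_simps)
    have "(44 - real_of_int 40667 / 10 ^ 7 * T) * u - 2244 / 100 * u\<^sup>2 \<le> real_of_int 10000033 / real_of_int 10000000 - 1
      - (if \<exists>i<44. int (a i) > champion ! i then real_of_int 460000000000 / 10 ^ 17 else 0)"
      unfolding T_def u_def V_def L_def
    proof (rule window_bound[OF q nq large])
      show "length champion = 44" by (simp add: champion_def)
      show "real_of_int 106408428154299 / 10 ^ 10 \<le> log_size champion" using log_size_champions(1) by simp
      show "1014176539783 / 15625000000 \<le> 1 + real_of_int 106408428154299 / 1665043439092" by simp
      show "real_of_int (prod_list (map (\<lambda>b. b + 1) champion) * 10000000) \<le> 55070053697523460000000000000000000000000000000000000000000000000000000000000000 * real_of_int 10000033"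
        unfolding prod_champions by simp
      show "- 1 / 100 \<le> (ln n - log_size champion) / (44 * ln 44 + log_size champion)"
        using u unfolding T_def u_def V_def L_def by simp
    qed (rule champion_checks champion_powers | simp)+
    \<comment> \<open>The linear coefficient exceeds 0.0497, while 22.44 u is below 0.0461. A
      nonnegative left side rules out the penalty 4.6 * 10^-6, which is larger than the slack 3.3 *
      10^-6; hence no exponent exceeds that of \<open>n_star\<close>.\<close>
    moreover have "0 \<le> (44 - 40667 / 10 ^ 7 * T) * u - 2244 / 100 * u\<^sup>2"
    proof -
      have "0 \<le> u * (44 - 40667 / 10 ^ 7 * T - 2244 / 100 * u)"
        using u T by (intro mult_nonneg_nonneg) linarith+
      then show ?thesis by (simp add: algebra_simps power2_eq_square)
    qed
    ultimately have "\<not> (\<exists>i<44. int (a i) > champion ! i)" by (auto split: if_splits)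
    then have le: "a i \<le> exponents ! i" if "i < 44" for i
      using that champion_nth[OF that] by (metis not_le of_nat_less_iff)
    show False
    proof (cases "\<exists>j<44. a j < exponents ! j")
      case True
      then obtain j where j: "j < 44" "a j < exponents ! j" by blast
      have "(\<Prod>i<44. real (a i) + 1) = (real (a j) + 1) * (\<Prod>i\<in>{..<44}-{j}. real (a i) + 1)"
        using j by (subst prod.remove[of _ j]) auto
      \<comment> \<open>Lowering an exponent e multiplies the factor e + 1 by at most e / (e + 1),
        and e is at most 354. Such a loss is far beyond the slack of order 10^-6.\<close>
      also have "\<dots> \<le> 354 / 355 * (real (exponents ! j) + 1) * (\<Prod>i\<in>{..<44}-{j}. real (exponents ! i) + 1)"
      proof (intro mult_mono prod_mono)
        show "real (a j) + 1 \<le> 354 / 355 * (real (exponents ! j) + 1)"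
        proof -
          have "real (a j) + 1 \<le> exponents ! j" "real (exponents ! j) \<le> 354"
            using j(2) exponents_bounds(2)[OF j(1)] by simp_all
          then show ?thesis by (simp add: field_simps)
        qed
      qed (use le in \<open>auto intro!: prod_nonneg\<close>)
      also have "\<dots> = 354 / 355 * (\<Prod>i<44. real (exponents ! i) + 1)"
        using j by (subst (2) prod.remove[of _ j]) auto
      finally have "(\<Prod>i<44. real (a i) + 1) \<le> 354 / 355 * 55070229630217149840617492052999215261045902171749515314891362769305600000000000" unfolding prod_exponents .
      moreover have "(1014176539783 / 15625000000) ^ 44 \<le> (\<Prod>i<44. real (a i) + 1)"
        using L0 \<open>L > L0\<close> by (intro lower[where S = 106408428154299]) auto
      ultimately show False using champion_powers(1) by linarith
    next
      case False
      then have eq: "a i = exponents ! i" if "i < 44" for i using le[OF that] that by force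
      have "\<exists>j<44. q j \<noteq> prime_seq j"
      proof (rule ccontr)
        assume "\<not> ?thesis"
        then have "n = n_star" unfolding nq n_star_eq using eq by (intro prod.cong) auto
        then show False using \<open>n > n_star\<close> by simp
      qed
      then obtain j where j: "j < 44" "prime_seq j < q j" using q by (metis le_neq_implies_less)
      have pos: "prime_seq i > 0" for i using prime_prime_seq[of i] by (rule prime_gt_0_nat)
      have pos_q: "q i > 0" if "i < 44" for i using q[OF that] pos[of i] by linarith
      have "L = (\<Sum>i<44. exponents ! i * ln (q i))"
        unfolding L_def nq using pos_q eq by (subst ln_eq_sum_factorization) auto
      moreover have "L0 = (\<Sum>i<44. exponents ! i * ln (prime_seq i))"
        unfolding L0_def log_size_def by (intro sum.cong) (auto simp: champion_nth)
      ultimately have "L - L0 = (\<Sum>i<44. exponents ! i * (ln (q i) - ln (prime_seq i)))"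
        by (simp add: sum_subtractf right_diff_distrib)
      also have "\<dots> \<ge> exponents ! j * (ln (q j) - ln (prime_seq j))"
        by (rule member_le_sum) (use j pos q pos_q in \<open>auto intro!: mult_nonneg_nonneg\<close>)
      finally have "exponents ! j * (ln (q j) - ln (prime_seq j)) \<le> L - L0" .
      \<comment> \<open>A replaced prime is at most 193 and grows by at least 1, with exponent at
        least 46. So \<open>ln n\<close> rises by at least 46/194 > 0.2, and the required 44th power
        overtakes the unchanged divisor count.\<close>
      moreover have "2 / 10 \<le> exponents ! j * (ln (q j) - ln (prime_seq j))"
      proof -
        have "list_all (\<lambda>p. p \<le> 193) (take 44 small_primes)" by (simp add: small_primes_def)
        then have "take 44 small_primes ! j \<le> 193"
          using j length_small_primes by (simp add: list_all_length)
        then have p: "prime_seq j \<le> 193" using prime_seq_eq_nth[of j] j by simp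
        have "1 / (real (prime_seq j) + 1) \<le> ln (Suc (prime_seq j)) - ln (prime_seq j)"
          using pos by (intro ln_Suc_bounds)
        also have "ln (Suc (prime_seq j)) \<le> ln (q j)" using j by (intro ln_mono) auto
        finally have "1 / (real (prime_seq j) + 1) \<le> ln (q j) - ln (prime_seq j)" by simp
        moreover have "1 / 194 \<le> 1 / (real (prime_seq j) + 1)"
          using p by (intro divide_left_mono) auto
        ultimately have "1 / 194 \<le> ln (q j) - ln (prime_seq j)" by linarith
        then have "46 * (1 / 194) \<le> exponents ! j * (ln (q j) - ln (prime_seq j))"
          using exponents_bounds(1)[OF j(1)] by (intro mult_mono) auto
        then show ?thesis by simp
      qed
      ultimately have "L \<ge> L0 + 2 / 10" by linarith
      then have "(8113562464497 / 125000000000) ^ 44 \<le> (\<Prod>i<44. real (a i) + 1)"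
        using L0 by (intro lower[where S = 106410428154299]) auto
      moreover have "(\<Prod>i<44. real (a i) + 1) = 55070229630217149840617492052999215261045902171749515314891362769305600000000000"
        unfolding prod_exponents[symmetric] using eq by (intro prod.cong) auto
      ultimately show False using champion_powers(5) by linarith
    qed
  qed
qed

theorem theorem5:
  shows "omega n_star \<ge> 44 \<and> lambda n_star \<ge> 1 \<and>
    (\<forall>n. omega n \<ge> 44 \<and> lambda n \<ge> 1 \<longrightarrow> n \<le> n_star)"
proof (intro conjI allI impI)
  show "omega n_star \<ge> 44" by (simp add: n_star_facts)
  show "lambda n_star \<ge> 1" by (rule lambda_n_star)
  fix n assume n: "omega n \<ge> 44 \<and> lambda n \<ge> 1"
  show "n \<le> n_star"
  proof (cases "omega n = 44")
    case True
    then show ?thesis using n by (intro le_n_star_if_omega_44) auto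
  next
    case False
    then have "ln n < 10640" using n by (intro ln_less_if_omega_ge_45) auto
    also have "10640 \<le> ln n_star"
      unfolding n_star_facts(4) using log_size_champions(1) by simp
    finally have "ln n < ln n_star" .
    moreover have "n > 0" using n by (cases n) (auto simp: omega_def)
    ultimately show ?thesis using n_star_facts(3) by simp
  qed
qed

end
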